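(* Let $\mu_i$ ($i\in\mathbb N$) and $\mu$ be nonzero finite Borel measures on $S^{n-1}$ which are not concentrated on any closed hemisphere, with $\mu_i\to\mu$ weakly. Let $G\in\mathcal G_I$ be a continuous function such that $t\mapsto G(t,u)$ is convex on $(0,\infty)$ for each $u\in S^{n-1}$ and, for some $q\ge n-1$, $$\inf\Big\{\frac{G(t,u)}{t^q}:\ t\ge 1,\ u\in S^{n-1}\Big\}>0.$$ Let $\varphi\in\mathcal I$ be convex. The following statements hold. i) Let $\widetilde M_i\in\widetilde{\mathcal B}$ ($i\in\mathbb N$) and $\widetilde M\in\widetilde{\mathcal B}$ be solutions of the minimization problem $$\inf\Big\{\int_{S^{n-1}}\varphi(h_Q(u))\,d\nu(u):Q\in\widetilde{\mathcal B}\Big\}$$ for $\nu=\mu_i$ and $\nu=\mu$, respectively (i.e. the infimum is attained at them). Then $\widetilde M_i\to\widetilde M$ as $i\to\infty$ in the Hausdorff metric. ii) Let $\widehat M_i\in\widehat{\mathcal B}$ ($i\in\mathbb N$) and $\widehat M\in\widehat{\mathcal B}$ be solutions of the minimization problem $$\inf\Big\{\int_{S^{n-1}}\varphi(h_Q(u))\,d\nu(u):Q\in\widehat{\mathcal B}\Big\}$$ for $\nu=\mu_i$ and $\nu=\mu$, respectively. Then $\widehat M_i\to\widehat M$ as $i\to\infty$ in the Hausdorff metric.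
   Context: Work in $\mathbb R^n$, $n\ge2$, with inner product $\langle\cdot,\cdot\rangle$, unit ball $B^n$ and unit sphere $S^{n-1}$; $du$ denotes the spherical measure on $S^{n-1}$ (the $(n-1)$-dimensional Hausdorff measure). $\mathcal K_{(o)}^n$ is the set of compact convex subsets of $\mathbb R^n$ with the origin $o$ in their interiors. For $K\in\mathcal K_{(o)}^n$ and $u\in S^{n-1}$: $h_K(u)=\max_{x\in K}\langle x,u\rangle$, $\rho_K(u)=\max\{\lambda\ge0:\lambda u\in K\}$, and $K^\circ=\{x\in\mathbb R^n:\langle x,y\rangle\le1\ \forall y\in K\}$. The Hausdorff metric is $d_H(K,L)=\max_{u\in S^{n-1}}|h_K(u)-h_L(u)|$. $\mathcal I$ is the set of continuous strictly increasing functions $\varphi:(0,\infty)\to(0,\infty)$ with $\lim_{t\to0^+}\varphi(t)=0$, $\varphi(1)=1$, $\lim_{t\to\infty}\varphi(t)=\infty$. $\mathcal G_I$ is the set of continuous $G:(0,\infty)\times S^{n-1}\to(0,\infty)$ such that for each $u\in S^{n-1}$, $t\mapsto G(t,u)$ is strictly increasing with $\lim_{t\to0^+}G(t,u)=0$ and $\lim_{t\to\infty}G(t,u)=\infty$. The general dual volume is $\widetilde V_G(K)=\int_{S^{n-1}}G(\rho_K(u),u)\,du$ for $K\in\mathcal K_{(o)}^n$. For $G\in\mathcal G_I$ the homogeneous general dual volume is $\widehat V_G(K)=\inf\{\eta>0:\int_{S^{n-1}}G(\rho_K(u)/\eta,u)\,du\le1\}$. Set $$\widetilde{\mathcal B}=\{Q\in\mathcal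 K_{(o)}^n:\widetilde V_G(Q^\circ)=\widetilde V_G(B^n)\},\qquad \widehat{\mathcal B}=\{Q\in\mathcal K_{(o)}^n:\widehat V_G(Q^\circ)=\widehat V_G(B^n)\}.$$ A finite Borel measure $\mu$ on $S^{n-1}$ is not concentrated on any closed hemisphere if $\mu(\{u\in S^{n-1}:\langle u,v\rangle>0\})>0$ for every $v\in S^{n-1}$. Weak convergence $\mu_i\to\mu$ means $\int f\,d\mu_i\to\int f\,d\mu$ for every continuous $f$ on $S^{n-1}$. *)

theory Defs
  imports "HOL-Analysis.Analysis"
begin

section \<open>Hausdorff measure of integer dimension and the spherical measure\<close>

text \<open>
  The weight \<open>\<omega>\<^sub>m (diam U / 2)\<^sup>m\<close>, with \<open>\<omega>\<^sub>m\<close> the volume of the \<open>m\<close>-dimensional unit ball,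
  is the usual normalisation: in \<open>m\<close>-dimensional Euclidean space the Hausdorff measure agrees
  with Lebesgue measure, and the unit sphere of an \<open>n\<close>-dimensional space has measure
  \<open>n \<omega>\<^sub>n\<close>. The empty set gets weight 0 also when \<open>m = 0\<close>.
\<close>
definition hausdorff_weight :: "nat \<Rightarrow> 'a::metric_space set \<Rightarrow> ennreal" where
  "hausdorff_weight m U =
     (if U = {} then 0 else ennreal (unit_ball_vol (real m) * (diameter U / 2) ^ m))"

text \<open>
  Boundedness of the covering sets is required explicitly, since \<^const>\<open>diameter\<close> is
  real-valued and meaningless on unbounded sets.
\<close>
definition hausdorff_premeasure :: "nat \<Rightarrow> real \<Rightarrow> 'a::metric_space set \<Rightarrow> ennreal" where
  "hausdorff_premeasure m \<delta> A =
     (INF U\<in>{U :: nat \<Rightarrow> 'a set. A \<subseteq> (\<Union>i. U i) \<and> (\<forall>i. bounded (U i) \<and> diameter (U i) \<le> \<delta>)}.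
        \<Sum>i. hausdorff_weight m (U i))"

definition hausdorff_outer_measure :: "nat \<Rightarrow> 'a::metric_space set \<Rightarrow> ennreal" where
  "hausdorff_outer_measure m A = (SUP \<delta>\<in>{0<..}. hausdorff_premeasure m \<delta> A)"

text \<open>
  This is a metric outer measure, so its restriction to the Borel sets is countably additive
  and \<^const>\<open>measure_of\<close> keeps its values.
\<close>
definition hausdorff_measure :: "nat \<Rightarrow> 'a::metric_space measure" where
  "hausdorff_measure m = measure_of UNIV (sets borel) (hausdorff_outer_measure m)"

definition spherical_measure :: "'a::euclidean_space measure" where
  "spherical_measure = restrict_space (hausdorff_measure (DIM('a) - 1)) (sphere 0 1)"


section \<open>Convex bodies\<close>

definition bodies_o :: "'a::euclidean_space set set" where
  "bodies_o = {K. compact K \<and> convex K \<and> 0 \<in> interior K}"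

text \<open>
  For the bodies considered here the suprema in the next two definitions, and the one in
  the Hausdorff distance, are attained.
\<close>
definition support_fun :: "'a::euclidean_space set \<Rightarrow> 'a \<Rightarrow> real" where
  "support_fun K u = (SUP x\<in>K. x \<bullet> u)"

definition radial_fun :: "'a::euclidean_space set \<Rightarrow> 'a \<Rightarrow> real" where
  "radial_fun K u = Sup {l. l \<ge> 0 \<and> l *\<^sub>R u \<in> K}"

definition polar_body :: "'a::euclidean_space set \<Rightarrow> 'a set" where
  "polar_body K = {x. \<forall>y\<in>K. x \<bullet> y \<le> 1}"

definition hausdorff_dist :: "'a::euclidean_space set \<Rightarrow> 'a set \<Rightarrow> real" where
  "hausdorff_dist K L = (SUP u\<in>sphere 0 1. \<bar>support_fun K u - support_fun L u\<bar>)"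


section \<open>The function classes\<close>

text \<open>
  Functions on \<open>(0,\<infinity>)\<close> and on \<open>(0,\<infinity>) \<times> S\<close> are total functions
  whose values outside these domains are irrelevant.
\<close>
definition class_I :: "(real \<Rightarrow> real) set" where
  "class_I = {\<phi>. continuous_on {0<..} \<phi> \<and> strict_mono_on {0<..} \<phi> \<and> (\<forall>t>0. \<phi> t > 0) \<and>
     (\<phi> \<longlongrightarrow> 0) (at_right 0) \<and> \<phi> 1 = 1 \<and> filterlim \<phi> at_top at_top}"

definition class_GI :: "(real \<times> 'a::euclidean_space \<Rightarrow> real) set" where
  "class_GI = {G. continuous_on ({0<..} \<times> sphere 0 1) G \<and>
     (\<forall>t>0. \<forall>u\<in>sphere 0 1. G (t, u) > 0) \<and>
     (\<forall>u\<in>sphere 0 1. strict_mono_on {0<..} (\<lambda>t. G (t, u)) \<and>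
        ((\<lambda>t. G (t, u)) \<longlongrightarrow> 0) (at_right 0) \<and> filterlim (\<lambda>t. G (t, u)) at_top at_top)}"


section \<open>General dual volumes\<close>

definition dual_vol :: "(real \<times> 'a::euclidean_space \<Rightarrow> real) \<Rightarrow> 'a set \<Rightarrow> real" where
  "dual_vol G K = (LINT u|spherical_measure. G (radial_fun K u, u))"

definition hom_dual_vol :: "(real \<times> 'a::euclidean_space \<Rightarrow> real) \<Rightarrow> 'a set \<Rightarrow> real" where
  "hom_dual_vol G K =
     Inf {\<eta>. \<eta> > 0 \<and> (LINT u|spherical_measure. G (radial_fun K u / \<eta>, u)) \<le> 1}"

definition B_tilde :: "(real \<times> 'a::euclidean_space \<Rightarrow> real) \<Rightarrow> 'a set set" where
  "B_tilde G = {Q \<in> bodies_o. dual_vol G (polar_body Q) = dual_vol G (cball 0 1)}"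

definition B_hat :: "(real \<times> 'a::euclidean_space \<Rightarrow> real) \<Rightarrow> 'a set set" where
  "B_hat G = {Q \<in> bodies_o. hom_dual_vol G (polar_body Q) = hom_dual_vol G (cball 0 1)}"


section \<open>Measures on the sphere and the minimization problem\<close>

definition finite_borel_measure_on_sphere :: "'a::euclidean_space measure \<Rightarrow> bool" where
  "finite_borel_measure_on_sphere \<mu> \<longleftrightarrow>
     sets \<mu> = sets (restrict_space borel (sphere 0 1)) \<and> finite_measure \<mu>"

definition not_conc_on_closed_hemisphere :: "'a::euclidean_space measure \<Rightarrow> bool" where
  "not_conc_on_closed_hemisphere \<mu> \<longleftrightarrow>
     (\<forall>v\<in>sphere 0 1. emeasure \<mu> {u \<in> sphere 0 1. u \<bullet> v > 0} > 0)"

definition weakly_converges ::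
    "(nat \<Rightarrow> 'a::euclidean_space measure) \<Rightarrow> 'a measure \<Rightarrow> bool" where
  "weakly_converges \<mu>s \<mu> \<longleftrightarrow>
     (\<forall>f :: 'a \<Rightarrow> real. continuous_on (sphere 0 1) f \<longrightarrow>
        (\<lambda>i. LINT u|\<mu>s i. f u) \<longlonglongrightarrow> (LINT u|\<mu>. f u))"

definition is_minimizer ::
    "(real \<Rightarrow> real) \<Rightarrow> 'a::euclidean_space measure \<Rightarrow> 'a set set \<Rightarrow> 'a set \<Rightarrow> bool" where
  "is_minimizer \<phi> \<nu> \<B> M \<longleftrightarrow> M \<in> \<B> \<and>
     (LINT u|\<nu>. \<phi> (support_fun M u)) = (INF Q\<in>\<B>. LINT u|\<nu>. \<phi> (support_fun Q u))"

end

theory Submission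
  imports Defs "HOL-Complex_Analysis.Great_Picard"
begin

text \<open>
  Since \<open>\<rho>(Q\<degree>) = 1 / h\<^sub>Q\<close>, everything can be phrased in terms of support functions. Testing with the
  unit ball bounds the minimizers from above, because \<open>\<phi>\<close> grows at least linearly; the growth of \<open>G\<close>
  bounds their support functions away from 0. By Arzela-Ascoli, a subsequence staying away from the
  limit body \<open>M\<close> has support functions converging uniformly to some \<open>g\<close>. If \<open>g \<noteq> h\<^sub>M\<close>, then by strict
  convexity of \<open>s \<mapsto> G(1 / s, u)\<close> the mean \<open>(g + h\<^sub>M) / 2\<close> has dual volume below the prescribed
  value, so it can be shrunk by a factor less than 1, and then the convex functional \<open>\<integral> \<phi>(h) d\<mu>\<close> takes
  on it a value below the minimum. The homogeneous problem is the inhomogeneous one for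
  \<open>G(t / \<eta>, u)\<close>, where \<open>\<eta>\<close> is the homogeneous dual volume of the unit ball.
\<close>

section \<open>The Hausdorff measure is a Borel measure\<close>

text \<open>The exponent n - 1 is the critical one. If the support function of a body in a fixed
  ball is small at \<open>v\<close>, it grows away from \<open>v\<close> at most linearly, so the
  integrand of the dual volume is at least of order |u - v|^-(n-1) there, which just fails to be
  integrable on a sphere of dimension n - 1. A bound on the dual volume therefore keeps the support
  function away from 0. Quantitatively this rests on caps of radius r having measure at least of
  order r^(n-1). As the spherical measure is given through coverings, this estimate and its
  finiteness are derived by comparison with Lebesgue measure in the ambient space. Neither
  \<open>G\<close> nor \<open>\<phi>\<close> is assumed strictly convex: strictness comes from the
  reciprocal 1 / s combined with strict monotonicity. A further obstacle is that the measures vary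
  with i. For each large i one and the same test body is inserted into the problem for
  \<open>\<mu>s i\<close> and into the one for \<open>\<mu>\<close>, and both inequalities survive
  the limit.\<close>

lemma metric_outer_measure_closed:
  fixes f :: "'a::metric_space set \<Rightarrow> ennreal"
  assumes oms: "outer_measure_space (Pow UNIV) f"
    and metric: "\<And>A B e. e > 0 \<Longrightarrow> (\<And>a b. a \<in> A \<Longrightarrow> b \<in> B \<Longrightarrow> e \<le> dist a b) \<Longrightarrow>
      f A + f B \<le> f (A \<union> B)"
    and F: "closed F"
  shows "F \<in> lambda_system UNIV (Pow UNIV) f"
proof -
  have pos: "f {} = 0" and inc: "\<And>A B. A \<subseteq> B \<Longrightarrow> f A \<le> f B" 
    and csub: "countably_subadditive (Pow UNIV) f"
    using oms by (auto simp: outer_measure_space_def positive_def increasing_def)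
  interpret ring_of_sets UNIV "Pow UNIV :: 'a set set" by (rule ring_of_sets_Pow)
  have add: "subadditive (Pow UNIV) f"
    using oms csub by (intro countably_subadditive_subadditive) (auto simp: outer_measure_space_def)
  have sub: "f (A \<union> B) \<le> f A + f B" for A B
  proof -
    have "f (A \<union> (B - A)) \<le> f A + f (B - A)"
      by (rule subadditiveD[OF add]) auto
    also have "\<dots> \<le> f A + f B" by (intro add_left_mono inc) auto
    finally show ?thesis by simp
  qed
  have csub': "f (\<Union>i. A i) \<le> (\<Sum>i. f (A i))" for A :: "nat \<Rightarrow> 'a set"
  proof -
    have "f (\<Union>i. disjointed A i) \<le> (\<Sum>i. f (disjointed A i))"
      using csub by (auto simp: countably_subadditive_def disjoint_family_disjointed)
    also have "\<dots> \<le> (\<Sum>i. f (A i))"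
      by (intro suminf_le inc disjointed_subset) auto
    finally show ?thesis by (simp add: UN_disjointed_eq)
  qed
  have "f (F \<inter> X) + f ((UNIV - F) \<inter> X) = f X" for X
  proof (rule antisym)
    show "f X \<le> f (F \<inter> X) + f ((UNIV - F) \<inter> X)"
      using sub[of "F \<inter> X" "(UNIV - F) \<inter> X"] inc[of X "F \<inter> X \<union> (UNIV - F) \<inter> X"] by force
    show "f (F \<inter> X) + f ((UNIV - F) \<inter> X) \<le> f X"
    \<comment> \<open>\<open>infdist\<close> to the empty set is 0 by convention, so the shells
      below would all be empty for \<open>F = {}\<close>; the summability argument needs
      \<open>f X\<close> finite.\<close>
    proof (cases "F = {} \<or> f X = \<infinity>")
      case True
      then show ?thesis using pos by auto
    next
      case False
      then have ne: "F \<noteq> {}" and fin: "f X < \<infinity>" by (auto simp: less_top)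
      \<comment> \<open>The part of \<open>X\<close> outside \<open>F\<close> is exhausted by the
        sets \<open>D k\<close> of points at distance at least 1 / (k + 1) from \<open>F\<close>,
        and \<open>R k\<close> is the shell between two consecutive ones.\<close>
      define D where "D k = {x \<in> X. 1 / (real k + 1) \<le> infdist x F}" for k
      define R where "R k = D (Suc k) - D k" for k
      have Dmono: "D j \<subseteq> D k" if "j \<le> k" for j k
      proof -
        have "1 / (real k + 1) \<le> 1 / (real j + 1)" using that by (simp add: frac_le)
        then show ?thesis by (auto simp: D_def)
      qed
      have UD: "(UNIV - F) \<inter> X \<subseteq> (\<Union>k. D k)"
      proof
        fix x assume x: "x \<in> (UNIV - F) \<inter> X"
        then have "infdist x F > 0" using infdist_pos_not_in_closed[OF F ne] by auto
        then obtain k where "inverse (real (Suc k)) < infdist x F" by (rule reals_Archimedean[THEN exE])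
        with x have "x \<in> D k" by (auto simp: D_def inverse_eq_divide add.commute)
        then show "x \<in> (\<Union>k. D k)" by blast
      qed
      have RX: "R k \<subseteq> X" for k by (auto simp: R_def D_def)
      have sep: "f (D k \<inter> Z) + f (R (Suc k)) \<le> f (D k \<inter> Z \<union> R (Suc k))" for k Z
      proof (rule metric)
        show "0 < 1 / (real k + 1) - 1 / (real (Suc k) + 1)" by (simp add: divide_strict_left_mono)
        fix a b assume "a \<in> D k \<inter> Z" "b \<in> R (Suc k)"
        then have "1 / (real k + 1) \<le> infdist a F" "infdist b F < 1 / (real (Suc k) + 1)"
          by (auto simp: D_def R_def)
        then show "1 / (real k + 1) - 1 / (real (Suc k) + 1) \<le> dist a b"
          using infdist_triangle[of a F b] by linarith
      qed
      \<comment> \<open>Neighbouring shells may touch, but shells two steps apart are separated by a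
        positive distance. So the metric property gives additivity along each parity class
        \<open>p\<close>.\<close>
      have alt: "(\<Sum>j<n. f (R (2 * j + p))) \<le> f (\<Union>j<n. R (2 * j + p))" for n p
      proof (induction n)
        case (Suc n)
        show ?case
        proof (cases n)
          case 0 then show ?thesis by (simp add: lessThan_Suc)
        next
          case (Suc m)
          define Z where "Z = (\<Union>j<n. R (2 * j + p))"
          have "R (2 * j + p) \<subseteq> D (2 * m + p + 1)" if "j < n" for j
            using that Suc Dmono[of "Suc (2 * j + p)" "2 * m + p + 1"] by (auto simp: R_def)
          then have ZD: "D (2 * m + p + 1) \<inter> Z = Z" by (auto simp: Z_def)
          have "(\<Sum>j<Suc n. f (R (2 * j + p))) \<le> f Z + f (R (2 * n + p))"
            using Suc.IH by (simp add: Z_def add_right_mono)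
          also have "\<dots> \<le> f (Z \<union> R (2 * n + p))"
            using sep[of "2 * m + p + 1" Z] ZD Suc by simp
          also have "Z \<union> R (2 * n + p) = (\<Union>j<Suc n. R (2 * j + p))"
            by (auto simp: Z_def less_Suc_eq)
          finally show ?thesis .
        qed
      qed (simp add: pos)
      have altX: "(\<Sum>j<n. f (R (2 * j + p))) \<le> f X" for n p
        using alt[where n=n and p=p] inc[of "\<Union>j<n. R (2 * j + p)" X] RX by (meson UN_least order_trans)
      have sum2: "(\<Sum>j<2*n. f (R j)) = (\<Sum>j<n. f (R (2 * j + 0))) + (\<Sum>j<n. f (R (2 * j + 1)))" for n
        by (induction n) (auto simp: algebra_simps)
      \<comment> \<open>Even and odd shells contribute at most \<open>f X\<close> each. Hence the
        series converges, and its tails, which bound what \<open>D N\<close> misses outside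
        \<open>F\<close>, tend to 0.\<close>
      have "(\<Sum>j. f (R j)) \<le> f X + f X"
        unfolding suminf_eq_SUP
      proof (rule SUP_least)
        fix n
        have "(\<Sum>j<n. f (R j)) \<le> (\<Sum>j<2*n. f (R j))" by (rule sum_mono2) auto
        also have "\<dots> \<le> f X + f X" unfolding sum2 by (intro add_mono altX)
        finally show "(\<Sum>j<n. f (R j)) \<le> f X + f X" .
      qed
      then have sfin: "(\<Sum>j. f (R j)) < \<infinity>" using fin by (simp add: order.strict_trans1)
      define r where "r j = enn2real (f (R j))" for j
      have "f (R j) < top" for j using inc[OF RX[of j]] fin by (auto simp: order.strict_trans1)
      then have r: "f (R j) = ennreal (r j)" for j by (simp add: r_def)
      have r0: "r j \<ge> 0" for j by (simp add: r_def)
      have sr: "summable r" using sfin r r0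
        by (intro summable_suminf_not_top) auto
      have "f (F \<inter> X) + f ((UNIV - F) \<inter> X) \<le> f X + ennreal e" if e: "e > 0" for e
      proof -
        obtain N where N: "\<And>n. n \<ge> N \<Longrightarrow> norm (\<Sum>i. r (i + n)) < e"
          using suminf_exist_split[OF e sr] by blast
        have "(UNIV - F) \<inter> X \<subseteq> D N \<union> (\<Union>i. R (i + N))"
        proof
          fix x assume x: "x \<in> (UNIV - F) \<inter> X"
          then obtain k where k: "x \<in> D k" using UD by blast
          show "x \<in> D N \<union> (\<Union>i. R (i + N))"
          proof (cases "x \<in> D N")
            case False
            define m where "m = (LEAST k. x \<in> D k)"
            have m: "x \<in> D m" unfolding m_def by (rule LeastI[of _ k]) (rule k)
            have mN: "\<not> m \<le> N" using False m Dmono by blast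
            then obtain l where l: "m = Suc l" by (cases m) auto
            have "x \<notin> D l" using l not_less_Least[of l "\<lambda>k. x \<in> D k"] m_def by auto
            then have "x \<in> R l" using m l by (auto simp: R_def)
            moreover have "l = (l - N) + N" using mN l by auto
            ultimately show ?thesis by (metis UN_I UnCI UNIV_I)
          qed simp
        qed
        then have "f ((UNIV - F) \<inter> X) \<le> f (D N) + f (\<Union>i. R (i + N))"
          using inc sub by (meson order_trans)
        also have "f (\<Union>i. R (i + N)) \<le> (\<Sum>i. f (R (i + N)))" by (rule csub')
        also have "\<dots> = ennreal (\<Sum>i. r (i + N))"
          unfolding r using r0 sr by (intro suminf_ennreal2) (auto simp: summable_iff_shift)
        also have "\<dots> \<le> ennreal e" using N[of N] by (intro ennreal_leI) auto
        finally have 1: "f ((UNIV - F) \<inter> X) \<le> f (D N) + ennreal e" by (simp add: add_left_mono)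
        have "f (F \<inter> X) + f (D N) \<le> f (F \<inter> X \<union> D N)"
        proof (rule metric)
          show "0 < 1 / (real N + 1)" by simp
          fix a b assume "a \<in> F \<inter> X" "b \<in> D N"
          then show "1 / (real N + 1) \<le> dist a b"
            using infdist_le[of a F b] by (auto simp: D_def dist_commute)
        qed
        also have "\<dots> \<le> f X" by (rule inc) (auto simp: D_def)
        finally have 2: "f (F \<inter> X) + f (D N) \<le> f X" .
        have "f (F \<inter> X) + f ((UNIV - F) \<inter> X) \<le> f (F \<inter> X) + (f (D N) + ennreal e)"
          using 1 by (rule add_left_mono)
        also have "\<dots> \<le> f X + ennreal e" using 2 by (simp add: add.assoc[symmetric] add_right_mono)
        finally show ?thesis .
      qed
      then show ?thesis by (rule ennreal_le_epsilon)
    qed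
  qed
  then show ?thesis by (auto simp: lambda_system_def)
qed

lemma metric_outer_measure_measure_space:
  fixes f :: "'a::metric_space set \<Rightarrow> ennreal"
  assumes oms: "outer_measure_space (Pow UNIV) f"
    and metric: "\<And>A B e. e > 0 \<Longrightarrow> (\<And>a b. a \<in> A \<Longrightarrow> b \<in> B \<Longrightarrow> e \<le> dist a b) \<Longrightarrow>
      f A + f B \<le> f (A \<union> B)"
  shows "measure_space UNIV (sets borel) f"
proof -
  have sa: "sigma_algebra UNIV (Pow UNIV :: 'a set set)" by (rule sigma_algebra_Pow)
  have L: "measure_space UNIV (lambda_system UNIV (Pow UNIV) f) f"
    by (rule sigma_algebra.caratheodory_lemma[OF sa oms])
  then have "sigma_algebra UNIV (lambda_system UNIV (Pow UNIV) f)"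
    by (simp add: measure_space_def)
  then have "sigma_sets UNIV (Collect closed) \<subseteq> lambda_system UNIV (Pow UNIV) f"
    using metric_outer_measure_closed[OF oms metric]
    by (intro sigma_algebra.sigma_sets_subset) auto
  then have "sets borel \<subseteq> lambda_system UNIV (Pow UNIV) f"
    by (simp add: borel_eq_closed)
  with L show ?thesis
    using sets.sigma_algebra_axioms[of "borel :: 'a measure"] by (intro measure_down[OF L]) auto
qed

section \<open>The Hausdorff outer measure as a metric outer measure\<close>

lemma hausdorff_weight_empty [simp]: "hausdorff_weight m {} = 0"
  by (simp add: hausdorff_weight_def)

lemma hausdorff_premeasure_le:
  assumes "A \<subseteq> (\<Union>i. U i)" "\<And>i. bounded (U i)" "\<And>i. diameter (U i) \<le> \<delta>"
  shows "hausdorff_premeasure m \<delta> A \<le> (\<Sum>i. hausdorff_weight m (U i))"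
  unfolding hausdorff_premeasure_def using assms by (intro INF_lower) auto

lemma hausdorff_premeasure_mono:
  assumes "A \<subseteq> B" "\<delta>' \<le> \<delta>"
  shows "hausdorff_premeasure m \<delta> A \<le> hausdorff_premeasure m \<delta>' B"
  unfolding hausdorff_premeasure_def
proof (rule INF_superset_mono)
  show "{U. B \<subseteq> (\<Union>i. U i) \<and> (\<forall>i. bounded (U i) \<and> diameter (U i) \<le> \<delta>')}
      \<subseteq> {U :: nat \<Rightarrow> _. A \<subseteq> (\<Union>i. U i) \<and> (\<forall>i. bounded (U i) \<and> diameter (U i) \<le> \<delta>)}"
    using assms by (auto intro: order_trans)
qed simp

lemma hausdorff_premeasure_Union:
  fixes A :: "nat \<Rightarrow> 'a::metric_space set"
  assumes "\<delta> > 0"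
  shows "hausdorff_premeasure m \<delta> (\<Union>i. A i) \<le> (\<Sum>i. hausdorff_premeasure m \<delta> (A i))"
proof (rule ennreal_le_epsilon)
  fix e :: real assume "0 < e" and fin: "(\<Sum>i. hausdorff_premeasure m \<delta> (A i)) < top"
  then have *: "hausdorff_premeasure m \<delta> (A n) < hausdorff_premeasure m \<delta> (A n) + e * (1/2)^Suc n" for n
    by (auto simp add: less_top dest!: ennreal_suminf_lessD)
  have "\<exists>U. A n \<subseteq> (\<Union>i. U i) \<and> (\<forall>i. bounded (U i) \<and> diameter (U i) \<le> \<delta>) \<and>
      (\<Sum>i. hausdorff_weight m (U i)) \<le> hausdorff_premeasure m \<delta> (A n) + e * (1/2)^Suc n" for n
    using *[of n] unfolding hausdorff_premeasure_def INF_less_iff by (auto intro: less_imp_le)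
  then obtain U where U: "\<And>n. A n \<subseteq> (\<Union>i. U n i)" "\<And>n i. bounded (U n i)"
      "\<And>n i. diameter (U n i) \<le> \<delta>" 
      "\<And>n. (\<Sum>i. hausdorff_weight m (U n i)) \<le> hausdorff_premeasure m \<delta> (A n) + e * (1/2)^Suc n"
    by metis
  \<comment> \<open>Near-optimal covers of the \<open>A n\<close>, with excess e / 2^(n+1), are
    merged into one sequence through the bijection of nat with pairs.\<close>
  define C where "C = case_prod U \<circ> prod_decode"
  have "hausdorff_premeasure m \<delta> (\<Union>i. A i) \<le> (\<Sum>i. hausdorff_weight m (C i))"
  proof (rule hausdorff_premeasure_le)
    show "(\<Union>i. A i) \<subseteq> (\<Union>i. C i)"
      using U(1) by (auto simp add: C_def subset_eq) (metis prod.case prod_encode_inverse)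
  qed (auto simp: C_def U split: prod.split)
  also have "\<dots> = (\<Sum>n. \<Sum>i. hausdorff_weight m (U n i))"
    unfolding C_def comp_def by (intro suminf_ennreal_2dimen) auto
  also have "\<dots> \<le> (\<Sum>n. hausdorff_premeasure m \<delta> (A n) + e * (1/2) ^ Suc n)"
    by (intro suminf_le U(4)) auto
  also have "... = (\<Sum>n. hausdorff_premeasure m \<delta> (A n)) + (\<Sum>n. ennreal e * ennreal ((1/2) ^ Suc n))"
    using \<open>0 < e\<close> by (subst suminf_add[symmetric])
      (auto simp del: ennreal_suminf_cmult simp add: ennreal_mult[symmetric])
  also have "\<dots> = (\<Sum>n. hausdorff_premeasure m \<delta> (A n)) + e"
    unfolding ennreal_suminf_cmult
    by (subst suminf_ennreal_eq[OF zero_le_power power_half_series]) auto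
  finally show "hausdorff_premeasure m \<delta> (\<Union>i. A i) \<le> (\<Sum>i. hausdorff_premeasure m \<delta> (A i)) + e" .
qed

lemma hausdorff_premeasure_le_outer:
  "\<delta> > 0 \<Longrightarrow> hausdorff_premeasure m \<delta> A \<le> hausdorff_outer_measure m A"
  unfolding hausdorff_outer_measure_def by (intro SUP_upper) auto

lemma hausdorff_outer_measure_space:
  "outer_measure_space (Pow UNIV) (hausdorff_outer_measure m :: 'a::metric_space set \<Rightarrow> ennreal)"
  unfolding outer_measure_space_def
proof (intro conjI)
  show "positive (Pow UNIV) (hausdorff_outer_measure m :: 'a set \<Rightarrow> ennreal)"
  proof -
    have "hausdorff_premeasure m \<delta> ({} :: 'a set) \<le> 0" if "\<delta> > 0" for \<delta>
      using hausdorff_premeasure_le[of "{}" "\<lambda>_. {}" \<delta> m] that by simp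
    then show ?thesis by (auto simp: positive_def hausdorff_outer_measure_def intro!: antisym SUP_least)
  qed
  show "increasing (Pow UNIV) (hausdorff_outer_measure m :: 'a set \<Rightarrow> ennreal)"
    unfolding increasing_def hausdorff_outer_measure_def
    by (intro ballI impI SUP_mono) (auto intro: hausdorff_premeasure_mono)
  show "countably_subadditive (Pow UNIV) (hausdorff_outer_measure m :: 'a set \<Rightarrow> ennreal)"
    unfolding countably_subadditive_def
  proof (intro allI impI)
    fix A :: "nat \<Rightarrow> 'a set"
    show "hausdorff_outer_measure m (\<Union>i. A i) \<le> (\<Sum>i. hausdorff_outer_measure m (A i))"
      unfolding hausdorff_outer_measure_def[of m "\<Union>i. A i"]
    proof (rule SUP_least)
      fix \<delta> :: real assume "\<delta> \<in> {0<..}"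
      then show "hausdorff_premeasure m \<delta> (\<Union>i. A i) \<le> (\<Sum>i. hausdorff_outer_measure m (A i))"
        using hausdorff_premeasure_Union[of \<delta> m A]
          suminf_le[of "\<lambda>i. hausdorff_premeasure m \<delta> (A i)" "\<lambda>i. hausdorff_outer_measure m (A i)"]
        by (auto intro: hausdorff_premeasure_le_outer order_trans)
    qed
  qed
qed

text \<open>A set of diameter below \<open>e\<close> cannot meet both \<open>A\<close> and
  \<open>B\<close>, so an admissible cover of the union splits into a cover of \<open>A\<close> and
  a cover of \<open>B\<close> that use different members.\<close>

lemma hausdorff_premeasure_separated:
  fixes A B :: "'a::metric_space set"
  assumes "\<delta> < e" and sep: "\<And>a b. a \<in> A \<Longrightarrow> b \<in> B \<Longrightarrow> e \<le> dist a b" and "\<delta> \<ge> 0"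
  shows "hausdorff_premeasure m \<delta> A + hausdorff_premeasure m \<delta> B \<le> hausdorff_premeasure m \<delta> (A \<union> B)"
  unfolding hausdorff_premeasure_def[of m \<delta> "A \<union> B"]
proof (rule INF_greatest)
  fix U :: "nat \<Rightarrow> 'a set"
  assume "U \<in> {U. A \<union> B \<subseteq> (\<Union>i. U i) \<and> (\<forall>i. bounded (U i) \<and> diameter (U i) \<le> \<delta>)}"
  then have U: "A \<union> B \<subseteq> (\<Union>i. U i)" "\<forall>i. bounded (U i) \<and> diameter (U i) \<le> \<delta>"
    by auto
  define V where "V C i = (if U i \<inter> C = {} then {} else U i)" for C i
  have pre: "hausdorff_premeasure m \<delta> C \<le> (\<Sum>i. hausdorff_weight m (V C i))" if "C \<subseteq> A \<union> B" for C
  proof (rule hausdorff_premeasure_le)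
    show "C \<subseteq> (\<Union>i. V C i)"
    proof
      fix x assume "x \<in> C"
      with U that obtain i where "x \<in> U i" by blast
      with \<open>x \<in> C\<close> have "x \<in> V C i" by (auto simp: V_def)
      then show "x \<in> (\<Union>i. V C i)" by blast
    qed
  qed (use U(2) \<open>\<delta> \<ge> 0\<close> in \<open>simp_all add: V_def\<close>)
  have "hausdorff_weight m (V A i) + hausdorff_weight m (V B i) \<le> hausdorff_weight m (U i)" for i
  proof -
    have "U i \<inter> A = {} \<or> U i \<inter> B = {}"
    proof (rule ccontr)
      assume "\<not> ?thesis"
      then obtain a b where "a \<in> U i" "a \<in> A" "b \<in> U i" "b \<in> B" by blast
      then have "e \<le> dist a b" "dist a b \<le> diameter (U i)" "diameter (U i) \<le> \<delta>"
        using sep U(2) by (auto intro: diameter_bounded_bound)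
      with assms(1) show False by linarith
    qed
    then show ?thesis by (auto simp: V_def)
  qed
  then have "(\<Sum>i. hausdorff_weight m (V A i)) + (\<Sum>i. hausdorff_weight m (V B i))
      \<le> (\<Sum>i. hausdorff_weight m (U i))"
    by (subst suminf_add) (auto intro: suminf_le)
  then show "hausdorff_premeasure m \<delta> A + hausdorff_premeasure m \<delta> B \<le> (\<Sum>i. hausdorff_weight m (U i))"
    using pre[of A] pre[of B] by (meson Un_upper1 Un_upper2 add_mono order_trans)
qed

text \<open>Suprema can be added along increasing sequences, hence a sequence of scales in place of
  all \<open>\<delta>\<close>. The offset 2 keeps every scale strictly below \<open>e\<close>, as
  the separation argument requires.\<close>

lemma hausdorff_outer_measure_eq_SUP_sequence:
  assumes "e > 0"
  shows "hausdorff_outer_measure m A = (SUP n. hausdorff_premeasure m (e / real (n + 2)) A)"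
  unfolding hausdorff_outer_measure_def
proof (rule SUP_eq)
  fix \<delta> :: real assume "\<delta> \<in> {0<..}"
  then have d: "\<delta> > 0" by simp
  obtain n where n: "e / \<delta> < real n" using reals_Archimedean2 by blast
  then have "e < real n * \<delta>" using d by (simp add: field_simps)
  also have "\<dots> \<le> real (n + 2) * \<delta>" using d by (intro mult_right_mono) auto
  finally have "e / real (n + 2) \<le> \<delta>" by (simp add: field_simps)
  then show "\<exists>n\<in>UNIV. hausdorff_premeasure m \<delta> A \<le> hausdorff_premeasure m (e / real (n + 2)) A"
    by (intro bexI[of _ n] hausdorff_premeasure_mono) auto
next
  fix n :: nat
  show "\<exists>\<delta>\<in>{0<..}. hausdorff_premeasure m (e / real (n + 2)) A \<le> hausdorff_premeasure m \<delta> A"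
    using assms by (intro bexI[of _ "e / real (n + 2)"] order.refl) simp
qed

lemma hausdorff_outer_measure_separated:
  fixes A B :: "'a::metric_space set"
  assumes e: "e > 0" and sep: "\<And>a b. a \<in> A \<Longrightarrow> b \<in> B \<Longrightarrow> e \<le> dist a b"
  shows "hausdorff_outer_measure m A + hausdorff_outer_measure m B \<le> hausdorff_outer_measure m (A \<union> B)"
proof -
  have inc: "incseq (\<lambda>n. hausdorff_premeasure m (e / real (n + 2)) C)" for C :: "'a set"
  proof (intro monoI hausdorff_premeasure_mono order.refl)
    fix j k :: nat assume "j \<le> k"
    then show "e / real (k + 2) \<le> e / real (j + 2)" using e by (intro frac_le) simp_all
  qed
  have "hausdorff_outer_measure m A + hausdorff_outer_measure m B
      = (SUP n. hausdorff_premeasure m (e / real (n + 2)) A + hausdorff_premeasure m (e / real (n + 2)) B)"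
    unfolding hausdorff_outer_measure_eq_SUP_sequence[OF e, of m A]
      hausdorff_outer_measure_eq_SUP_sequence[OF e, of m B]
    by (rule ennreal_SUP_add[OF inc inc, symmetric])
  also have "\<dots> \<le> hausdorff_outer_measure m (A \<union> B)"
    unfolding hausdorff_outer_measure_eq_SUP_sequence[OF e, of m "A \<union> B"]
  proof (rule SUP_mono)
    fix n :: nat
    have "e / real (n + 2) < e" using e by (simp add: field_simps add_pos_nonneg)
    then show "\<exists>k\<in>UNIV. hausdorff_premeasure m (e / real (n + 2)) A
        + hausdorff_premeasure m (e / real (n + 2)) B \<le> hausdorff_premeasure m (e / real (k + 2)) (A \<union> B)"
      using e by (intro bexI[of _ n] hausdorff_premeasure_separated[where e=e] sep) simp_all
  qed
  finally show ?thesis .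
qed

lemma sets_hausdorff_measure [simp]: "sets (hausdorff_measure m :: 'a::metric_space measure) = sets borel"
  unfolding hausdorff_measure_def
  using sets.sigma_sets_eq[of "borel :: 'a measure"] by (simp add: sets_measure_of)

text \<open>\<open>measure_of\<close> assigns 0 to every set unless the given function is a measure
  on the sigma-algebra, so countable additivity has to be proved before any value is known.\<close>

lemma emeasure_hausdorff_measure:
  assumes "A \<in> sets borel"
  shows "emeasure (hausdorff_measure m :: 'a::metric_space measure) A = hausdorff_outer_measure m A"
proof -
  have ms: "measure_space UNIV (sets borel) (hausdorff_outer_measure m :: 'a set \<Rightarrow> ennreal)"
    by (rule metric_outer_measure_measure_space[OF hausdorff_outer_measure_space])
       (rule hausdorff_outer_measure_separated)
  then show ?thesis unfolding hausdorff_measure_def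
    using assms by (intro emeasure_measure_of_sigma) (auto simp: measure_space_def)
qed

lemma space_spherical_measure [simp]: "space (spherical_measure :: 'a::euclidean_space measure) = sphere 0 1"
  by (simp add: spherical_measure_def space_restrict_space hausdorff_measure_def)

lemma sets_spherical_measure:
  "sets (spherical_measure :: 'a::euclidean_space measure) = sets (restrict_space borel (sphere 0 1))"
  by (simp add: spherical_measure_def sets_restrict_space)

lemma emeasure_spherical_measure:
  fixes A :: "'a::euclidean_space set"
  assumes "A \<in> sets borel" "A \<subseteq> sphere 0 1"
  shows "emeasure spherical_measure A = hausdorff_outer_measure (DIM('a) - 1) A"
  using assms by (simp add: spherical_measure_def emeasure_restrict_space emeasure_hausdorff_measure)

section \<open>The spherical measure is finite and positive on caps\<close>

lemma power_shell_le:
  fixes e :: real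
  assumes "0 \<le> e" "e \<le> 1"
  shows "(1 + e) ^ n - (1 - e) ^ n \<le> e * real n * 2 ^ n"
proof (induction n)
  case (Suc n)
  have "(1 + e) ^ n \<le> 2 ^ n" "(1 - e) ^ n \<le> 2 ^ n"
    using assms by (intro power_mono; simp)+
  then have "e * ((1 + e) ^ n + (1 - e) ^ n) \<le> e * (2 * 2 ^ n)"
    using assms by (intro mult_left_mono) auto
  moreover have "e * real n * 2 ^ n \<ge> 0" using assms by simp
  moreover have "(1 + e) ^ Suc n - (1 - e) ^ Suc n
      = ((1 + e) ^ n - (1 - e) ^ n) + e * ((1 + e) ^ n + (1 - e) ^ n)"
    by (simp add: algebra_simps)
  moreover have "e * real (Suc n) * 2 ^ Suc n = 2 * (e * real n * 2 ^ n) + e * (2 * 2 ^ n)"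
    by (simp add: algebra_simps)
  ultimately show ?case using Suc by linarith
qed simp

text \<open>The balls of radius \<open>e\<close> around the points of \<open>F\<close> are disjoint
  and lie in the shell between the radii 1 - e and 1 + e. The volume of this shell is of order
  \<open>e\<close> by \<open>power_shell_le\<close>, which yields the exponent n - 1 instead of
  n.\<close>

lemma separated_subset_sphere_card_le:
  fixes F :: "'a::euclidean_space set"
  assumes F: "finite F" "F \<subseteq> sphere 0 1" and sep: "\<And>x y. x \<in> F \<Longrightarrow> y \<in> F \<Longrightarrow> x \<noteq> y \<Longrightarrow> 2 * e \<le> dist x y"
    and e: "0 < e" "e \<le> 1"
  shows "real (card F) * e ^ (DIM('a) - 1) \<le> real DIM('a) * 2 ^ DIM('a)"
proof -
  define w where "w = unit_ball_vol (real DIM('a))"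
  have w: "w > 0" by (simp add: w_def)
  define U where "U = (\<Union>x\<in>F. ball x e)"
  have disj: "disjoint_family_on (\<lambda>x. ball x e) F"
    unfolding disjoint_family_on_def
  proof (intro ballI impI)
    fix x y assume "x \<in> F" "y \<in> F" "x \<noteq> y"
    then have "2 * e \<le> dist x y" by (rule sep)
    then show "ball x e \<inter> ball y e = {}" by (intro disjoint_ballI) simp
  qed
  have "(\<Sum>x\<in>F. emeasure lborel (ball x e)) = emeasure lborel U"
    unfolding U_def using F(1) disj by (intro sum_emeasure) auto
  moreover have "(\<Sum>x\<in>F. emeasure lborel (ball x e)) = ennreal (real (card F) * (w * e ^ DIM('a)))"
    using e w by (simp add: emeasure_ball w_def ennreal_mult' ennreal_of_nat_eq_real_of_nat)
  ultimately have U: "emeasure lborel U = ennreal (real (card F) * (w * e ^ DIM('a)))" by simp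
  have nx: "norm x = 1" if "x \<in> F" for x using F that by auto
  have "emeasure lborel U + emeasure lborel (ball (0::'a) (1 - e)) = emeasure lborel (U \<union> ball 0 (1 - e))"
  proof (rule plus_emeasure)
    show "U \<inter> ball 0 (1 - e) = {}"
    proof -
      have False if "x \<in> F" "dist x y < e" "norm y < 1 - e" for x y
        using nx[OF that(1)] that norm_triangle_ineq2[of x y] by (simp add: dist_norm)
      then show ?thesis by (auto simp: U_def)
    qed
  qed (auto simp: U_def intro!: borel_open open_UN)
  also have "\<dots> \<le> emeasure lborel (ball (0::'a) (1 + e))"
  proof (rule emeasure_mono)
    have "norm y < 1 + e" if "x \<in> F" "dist x y < e" for x y
      using nx[OF that(1)] that norm_triangle_ineq2[of y x] by (simp add: dist_norm norm_minus_commute)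
    then show "U \<union> ball 0 (1 - e) \<subseteq> ball 0 (1 + e)" using e by (auto simp: U_def)
  qed auto
  finally have "ennreal (real (card F) * (w * e ^ DIM('a))) + ennreal (w * (1 - e) ^ DIM('a))
      \<le> ennreal (w * (1 + e) ^ DIM('a))"
    using e by (simp add: U emeasure_ball w_def)
  then have "real (card F) * (w * e ^ DIM('a)) + w * (1 - e) ^ DIM('a) \<le> w * (1 + e) ^ DIM('a)"
  proof -
    have "0 \<le> real (card F) * (w * e ^ DIM('a))" "0 \<le> w * (1 - e) ^ DIM('a)" "0 \<le> w * (1 + e) ^ DIM('a)"
      using e w by simp_all
    with \<open>ennreal _ + ennreal _ \<le> _\<close> show ?thesis by (metis ennreal_le_iff ennreal_plus)
  qed
  then have "w * (real (card F) * e ^ DIM('a)) \<le> w * ((1 + e) ^ DIM('a) - (1 - e) ^ DIM('a))"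
    by (simp add: algebra_simps)
  then have "real (card F) * e ^ DIM('a) \<le> (1 + e) ^ DIM('a) - (1 - e) ^ DIM('a)"
    using w by simp
  also have "\<dots> \<le> e * real DIM('a) * 2 ^ DIM('a)" using e by (intro power_shell_le) auto
  finally have "e * (real (card F) * e ^ (DIM('a) - 1)) \<le> e * (real DIM('a) * 2 ^ DIM('a))"
    by (simp add: power_eq_if ac_simps)
  then show ?thesis using e by simp
qed

text \<open>A maximal 2e-separated subset of the sphere has at most of order e^-(n-1) points, and
  the balls of radius 2e around them cover the sphere. The sum of their weights is bounded
  independently of the scale.\<close>

lemma hausdorff_outer_measure_sphere_finite:
  "hausdorff_outer_measure (DIM('a) - 1) (sphere (0::'a::euclidean_space) 1) < \<infinity>"
proof -
  define p where "p = DIM('a) - 1"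
  define C where "C = unit_ball_vol (real p) * 2 ^ p * (real DIM('a) * 2 ^ DIM('a))"
  have "hausdorff_premeasure p \<delta> (sphere (0::'a) 1) \<le> ennreal C" if "\<delta> > 0" for \<delta>
  proof -
    \<comment> \<open>The packing bound asks for \<open>e \<le> 1\<close>; the quarter makes the
      diameters of balls of radius 2e at most \<open>\<delta>\<close>.\<close>
    define e where "e = min 1 (\<delta> / 4)"
    have e: "0 < e" "e \<le> 1" "4 * e \<le> \<delta>" using that by (auto simp: e_def)
    define P where "P F \<longleftrightarrow> finite F \<and> F \<subseteq> sphere (0::'a) 1 \<and>
      (\<forall>x\<in>F. \<forall>y\<in>F. x \<noteq> y \<longrightarrow> 2 * e \<le> dist x y)" for F
    have bound: "real (card F) * e ^ p \<le> real DIM('a) * 2 ^ DIM('a)" if "P F" for F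
      unfolding p_def by (rule separated_subset_sphere_card_le) (use that e in \<open>auto simp: P_def\<close>)
    obtain b :: nat where b: "(real DIM('a) * 2 ^ DIM('a)) / e ^ p < real b"
      using reals_Archimedean2 by blast
    have "card F < b" if "P F" for F
    proof -
      have "real (card F) \<le> (real DIM('a) * 2 ^ DIM('a)) / e ^ p"
        using bound[OF that] e by (simp add: field_simps)
      with b have "real (card F) < real b" by linarith
      then show ?thesis by simp
    qed
    moreover have "P {}" by (simp add: P_def)
    \<comment> \<open>The packing bound limits the cardinality, so a separated set of largest
      cardinality exists; a point left uncovered by it could be added to it.\<close>
    ultimately obtain F where F: "P F" and mx: "\<And>F'. P F' \<Longrightarrow> card F' \<le> card F"
      using ex_has_greatest_nat[of P "{}" card b] by blast
    have cov: "\<exists>x\<in>F. dist x y < 2 * e" if y: "norm y = 1" for y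
    proof (rule ccontr)
      assume no: "\<not> ?thesis"
      then have "P (insert y F)" "y \<notin> F"
        using F y e by (force simp: P_def dist_commute not_less)+
      with mx[of "insert y F"] F show False by (simp add: P_def)
    qed
    have "finite F" using F by (simp add: P_def)
    then obtain g where g: "F = g ` {i::nat. i < card F}"
      using finite_imp_nat_seg_image_inj_on[of F] card_image by (metis card_Collect_less_nat)
    \<comment> \<open>Empty sets, whose weight is 0 in every dimension, extend the finite cover to a
      sequence.\<close>
    define V where "V i = (if i < card F then ball (g i) (2 * e) else {})" for i
    have dV: "diameter (V i) \<le> 4 * e" for i
    proof (rule diameter_le)
      fix x y assume "x \<in> V i" "y \<in> V i"
      then show "norm (x - y) \<le> 4 * e"
        using dist_triangle_half_r[of "g i" x "4 * e" y]
        by (auto simp: V_def dist_norm split: if_splits)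
    qed (use e in auto)
    have bV: "bounded (V i)" for i by (simp add: V_def)
    have "hausdorff_premeasure p \<delta> (sphere (0::'a) 1) \<le> (\<Sum>i. hausdorff_weight p (V i))"
    proof (rule hausdorff_premeasure_le)
      show "sphere 0 1 \<subseteq> (\<Union>i. V i)"
      proof
        fix y :: 'a assume "y \<in> sphere 0 1"
        then obtain x where "x \<in> F" "dist x y < 2 * e" using cov by auto
        then obtain i where "i < card F" "x = g i" by (subst (asm) g) auto
        then have "y \<in> V i" using \<open>dist x y < 2 * e\<close> by (simp add: V_def)
        then show "y \<in> (\<Union>i. V i)" by blast
      qed
    qed (use bV dV e in \<open>auto intro: order_trans\<close>)
    also have "\<dots> = (\<Sum>i<card F. hausdorff_weight p (V i))"
      by (rule suminf_finite) (auto simp: V_def)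
    also have "\<dots> \<le> (\<Sum>i<card F. ennreal (unit_ball_vol (real p) * (2 * e) ^ p))"
    proof (rule sum_mono)
      fix i
      have "(diameter (V i) / 2) ^ p \<le> (2 * e) ^ p"
        using dV[of i] diameter_ge_0[OF bV[of i]] by (intro power_mono) auto
      then show "hausdorff_weight p (V i) \<le> ennreal (unit_ball_vol (real p) * (2 * e) ^ p)"
        by (auto simp: hausdorff_weight_def intro!: ennreal_leI mult_left_mono)
    qed
    also have "\<dots> = ennreal (real (card F) * (unit_ball_vol (real p) * (2 * e) ^ p))"
      using e by (simp add: ennreal_mult' ennreal_of_nat_eq_real_of_nat)
    also have "\<dots> = ennreal (unit_ball_vol (real p) * 2 ^ p * (real (card F) * e ^ p))"
      by (simp add: power_mult_distrib ac_simps)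
    also have "\<dots> \<le> ennreal C"
      unfolding C_def using bound[OF F] by (intro ennreal_leI mult_left_mono) auto
    finally show ?thesis .
  qed
  then have "hausdorff_outer_measure p (sphere (0::'a) 1) \<le> ennreal C"
    unfolding hausdorff_outer_measure_def by (intro SUP_least) auto
  then show ?thesis unfolding p_def using order.strict_trans1 by fastforce
qed

section \<open>Lower bound for the measure of caps\<close>

text \<open>Turns a Hausdorff weight into a Lebesgue volume. Attaching segments of half-length
  \<open>r\<close> to a set of diameter at most \<open>d\<close> gives volume at most of order r
  d^(n-1), because about r / d balls of radius 2d with centres on a line cover the result. The bound
  \<open>d\<close> is kept apart from the diameter because it has to be positive, while a singleton
  has diameter 0.\<close>

lemma emeasure_thickened_le:
  fixes U :: "'a::euclidean_space set"
  assumes U: "bounded U" "U \<noteq> {}" and v: "norm v = 1" and d: "diameter U \<le> d" "0 < d" "d \<le> r"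
    and m: "{y + t *\<^sub>R v | y t. y \<in> U \<and> \<bar>t\<bar> \<le> r} \<in> sets lborel" (is "?T \<in> _")
  shows "emeasure lborel {y + t *\<^sub>R v | y t. y \<in> U \<and> \<bar>t\<bar> \<le> r}
     \<le> ennreal (5 * 2 ^ DIM('a) * unit_ball_vol (real DIM('a)) * r * d ^ (DIM('a) - 1))"
proof -
  define w where "w = unit_ball_vol (real DIM('a))"
  have w: "w > 0" by (simp add: w_def)
  obtain x0 where x0: "x0 \<in> U" using U by blast
  define J where "J = \<lceil>r / d\<rceil>"
  have J1: "of_int J \<le> r / d + 1" "r / d \<le> of_int J" by (simp_all add: J_def)
  have "0 \<le> r / d" using d by simp
  with J1 have J0: "J \<ge> 0" by linarith
  let ?B = "\<lambda>j::int. cball (x0 + (of_int j * d) *\<^sub>R v) (2 * d)"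
  have "?T \<subseteq> (\<Union>j\<in>{-J..J}. ?B j)"
  proof clarify
    fix y t assume y: "y \<in> U" and t: "\<bar>t\<bar> \<le> r"
    define j where "j = \<lfloor>t / d\<rfloor>"
    have "\<bar>t / d\<bar> \<le> r / d" using t d by (simp add: divide_right_mono)
    then have td: "t / d \<le> of_int J" "- of_int J \<le> t / d" using J1 by linarith+
    then have "j \<le> J" "- J \<le> j" unfolding j_def by linarith+
    have "\<bar>t / d - of_int j\<bar> \<le> 1" unfolding j_def by linarith
    then have "\<bar>t / d - of_int j\<bar> * d \<le> 1 * d" using d by (intro mult_right_mono) auto
    then have tj: "\<bar>t - of_int j * d\<bar> \<le> d"
      using d by (simp add: abs_mult_pos' flip: abs_mult_pos) (simp add: field_simps)
    have "norm (y - x0) \<le> d"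
      using diameter_bounded_bound[OF U(1) y x0] d by (simp add: dist_norm)
    moreover have "norm ((t - of_int j * d) *\<^sub>R v) \<le> d" using tj v by simp
    ultimately have "norm ((y - x0) + (t - of_int j * d) *\<^sub>R v) \<le> 2 * d"
      using norm_triangle_ineq[of "y - x0" "(t - of_int j * d) *\<^sub>R v"] by linarith
    moreover have "(y - x0) + (t - of_int j * d) *\<^sub>R v = (y + t *\<^sub>R v) - (x0 + (of_int j * d) *\<^sub>R v)"
      by (simp add: algebra_simps)
    ultimately have "y + t *\<^sub>R v \<in> ?B j" by (simp add: dist_norm norm_minus_commute)
    with \<open>j \<le> J\<close> \<open>- J \<le> j\<close> show "y + t *\<^sub>R v \<in> (\<Union>j\<in>{-J..J}. ?B j)" by auto
  qed
  then have "emeasure lborel ?T \<le> emeasure lborel (\<Union>j\<in>{-J..J}. ?B j)"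
    by (intro emeasure_mono) auto
  also have "\<dots> \<le> (\<Sum>j\<in>{-J..J}. emeasure lborel (?B j))"
    by (rule emeasure_subadditive_finite) auto
  also have "\<dots> = ennreal (real (card {-J..J}) * (w * (2 * d) ^ DIM('a)))"
    using d w by (simp add: emeasure_cball w_def ennreal_mult' ennreal_of_nat_eq_real_of_nat)
  also have "\<dots> \<le> ennreal (5 * 2 ^ DIM('a) * w * r * d ^ (DIM('a) - 1))"
  proof (rule ennreal_leI)
    have "real (card {-J..J}) = 2 * of_int J + 1" using J0 by simp
    also have "\<dots> \<le> 2 * (r / d) + 3" using J1 by simp
    \<comment> \<open>By \<open>d \<le> r\<close> the summand 3 is at most 3 r / d.\<close>
    also have "\<dots> \<le> 5 * (r / d)" using d by (simp add: field_simps)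
    finally have "real (card {-J..J}) * (w * (2 * d) ^ DIM('a)) \<le> 5 * (r / d) * (w * (2 * d) ^ DIM('a))"
      using w d by (intro mult_right_mono) auto
    also have "\<dots> = 5 * 2 ^ DIM('a) * w * r * (d ^ DIM('a) / d)"
      by (simp add: power_mult_distrib)
    also have "d ^ DIM('a) / d = d ^ (DIM('a) - 1)"
      using d by (simp add: power_eq_if)
    finally show "real (card {-J..J}) * (w * (2 * d) ^ DIM('a)) \<le> 5 * 2 ^ DIM('a) * w * r * d ^ (DIM('a) - 1)" .
  qed
  finally show ?thesis by (simp add: w_def)
qed

text \<open>For any cover of the cap by sets of diameter at most r / 2, thickening the members in
  direction \<open>v\<close> covers the ball of radius r / 2 around \<open>v\<close>. Comparing
  Lebesgue volumes bounds the sum of the weights from below. The constant is crude; what matters is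
  that it does not depend on \<open>v\<close> and \<open>r\<close>.\<close>

lemma hausdorff_outer_measure_cap_ge:
  fixes v :: "'a::euclidean_space"
  assumes v: "norm v = 1" and r: "0 < r" "r \<le> 1"
  shows "ennreal (unit_ball_vol (real (DIM('a) - 1)) / (5 * 4 ^ DIM('a) * 2 ^ (DIM('a) - 1)) * r ^ (DIM('a) - 1))
    \<le> hausdorff_outer_measure (DIM('a) - 1) (sphere 0 1 \<inter> cball v r)"
proof -
  define p where "p = DIM('a) - 1"
  define w where "w = unit_ball_vol (real DIM('a))"
  define w' where "w' = unit_ball_vol (real p)"
  have w: "w > 0" "w' > 0" by (auto simp: w_def w'_def)
  \<comment> \<open>The factor between the Hausdorff weight of a set and the volume bound for its
    thickening; \<open>2 ^ p\<close> undoes the halving of the diameter in the weight.\<close>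
  define K where "K = 5 * 2 ^ DIM('a) * w * r * 2 ^ p / w'"
  have K: "K > 0" using w r by (simp add: K_def)
  \<comment> \<open>The single scale \<open>r / 2\<close> is enough, since the premeasure at any
    scale bounds the outer measure from below.\<close>
  have "ennreal (w' / (5 * 4 ^ DIM('a) * 2 ^ p) * r ^ p) \<le> hausdorff_premeasure p (r / 2) (sphere 0 1 \<inter> cball v r)"
    unfolding hausdorff_premeasure_def
  proof (rule INF_greatest)
    fix U :: "nat \<Rightarrow> 'a set"
    assume "U \<in> {U. sphere 0 1 \<inter> cball v r \<subseteq> (\<Union>i. U i) \<and> (\<forall>i. bounded (U i) \<and> diameter (U i) \<le> r / 2)}"
    then have cov: "sphere 0 1 \<inter> cball v r \<subseteq> (\<Union>i. U i)" and bU: "\<And>i. bounded (U i)"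
      and dU: "\<And>i. diameter (U i) \<le> r / 2" by auto
    \<comment> \<open>Closures have the same diameters and make the thickened sets compact, hence
      measurable.\<close>
    define T where "T i = {y + t *\<^sub>R v | y t. y \<in> closure (U i) \<and> \<bar>t\<bar> \<le> r}" for i
    have "compact (T i)" for i
    proof -
      have "compact (closure (U i) \<times> {-r..r})" using bU by (intro compact_Times) (auto simp: compact_closure)
      then have "compact ((\<lambda>(y, t). y + t *\<^sub>R v) ` (closure (U i) \<times> {-r..r}))"
        by (rule compact_continuous_image[rotated]) (auto simp: split_def intro!: continuous_intros)
      moreover have "(\<lambda>(y, t). y + t *\<^sub>R v) ` (closure (U i) \<times> {-r..r}) = T i"
        by (force simp: T_def abs_le_iff)
      ultimately show ?thesis by simp
    qed
    then have mT: "T i \<in> sets lborel" for i by (simp add: borel_compact)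
    \<comment> \<open>A point x = v + z of the ball is slid in direction \<open>v\<close> to the
      point \<open>y\<close> of the sphere with the same component \<open>u\<close> orthogonal to
      \<open>v\<close>. The distance from \<open>y\<close> to \<open>v\<close> and the length of the
      slide are both at most twice the norm of \<open>z\<close>.\<close>
    have "ball v (r / 2) \<subseteq> (\<Union>i. T i)"
    proof
      fix x assume x: "x \<in> ball v (r / 2)"
      define z where "z = x - v"
      have z: "norm z < r / 2" using x by (simp add: z_def dist_norm norm_minus_commute)
      define s where "s = z \<bullet> v"
      define u where "u = z - s *\<^sub>R v"
      have vv: "v \<bullet> v = 1" using v by (simp add: norm_eq_1)
      have uv: "u \<bullet> v = 0" by (simp add: u_def s_def inner_diff_left vv)
      have zz: "(norm z)\<^sup>2 = (norm u)\<^sup>2 + s\<^sup>2"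
      proof -
        have "z = u + s *\<^sub>R v" by (simp add: u_def)
        then show ?thesis
          using uv vv unfolding power2_norm_eq_inner
          by (simp add: inner_add_left inner_add_right inner_commute power2_eq_square)
      qed
      then have "(norm u)\<^sup>2 \<le> (norm z)\<^sup>2" "s\<^sup>2 \<le> (norm z)\<^sup>2" by simp_all
      then have u: "norm u \<le> norm z" and s: "\<bar>s\<bar> \<le> norm z"
        by (auto intro: power2_le_imp_le)
      define c where "c = sqrt (1 - (norm u)\<^sup>2)"
      have u1: "norm u < 1" using u z r by linarith
      then have u2: "(norm u)\<^sup>2 \<le> 1" "(norm u)\<^sup>2 \<le> norm u"
        by (auto simp: power2_eq_square mult_left_le mult_le_one)
      have c0: "c \<ge> 0" "c \<le> 1" and c2: "c\<^sup>2 = 1 - (norm u)\<^sup>2" using u2 by (auto simp: c_def)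
      have "c\<^sup>2 \<le> c" using c0 by (simp add: power2_eq_square mult_left_le)
      then have c1: "1 - c \<le> norm u" using c2 u2 by linarith
      define y where "y = u + c *\<^sub>R v"
      have "(norm y)\<^sup>2 = 1"
        using uv vv c2 unfolding y_def power2_norm_eq_inner
        by (simp add: inner_add_left inner_add_right inner_commute power2_eq_square)
      then have y1: "norm y = 1" by (simp add: power2_eq_1_iff) (use norm_ge_zero[of y] in linarith)
      have "norm (y - v) \<le> norm u + norm ((c - 1) *\<^sub>R v)"
        unfolding y_def using norm_triangle_ineq[of u "(c - 1) *\<^sub>R v"] by (simp add: algebra_simps)
      also have "\<dots> \<le> r" using v c0 c1 u z by simp
      finally have "y \<in> sphere 0 1 \<inter> cball v r"
        using y1 by (simp add: dist_norm norm_minus_commute)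
      then obtain i where "y \<in> U i" using cov by blast
      then have "y \<in> closure (U i)" using closure_subset by blast
      moreover have "x = y + (1 + s - c) *\<^sub>R v"
        by (simp add: y_def u_def z_def algebra_simps)
      moreover have "\<bar>1 + s - c\<bar> \<le> r" using c0 c1 s u z by linarith
      ultimately have "x \<in> T i" by (auto simp: T_def)
      then show "x \<in> (\<Union>i. T i)" by blast
    qed
    then have "emeasure lborel (ball v (r / 2)) \<le> emeasure lborel (\<Union>i. T i)"
      using mT by (intro emeasure_mono) auto
    also have "\<dots> \<le> (\<Sum>i. emeasure lborel (T i))"
      using mT by (intro emeasure_subadditive_countably) auto
    also have "\<dots> \<le> (\<Sum>i. ennreal K * hausdorff_weight p (U i))"
    proof (intro suminf_le summableI)
      fix i
      show "emeasure lborel (T i) \<le> ennreal K * hausdorff_weight p (U i)"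
      proof (cases "U i = {}")
        case True
        then show ?thesis by (simp add: T_def)
      next
        case False
        define D where "D = diameter (U i)"
        have D: "0 \<le> D" "D \<le> r / 2" using dU bU by (auto simp: D_def diameter_ge_0)
        \<comment> \<open>The diameter may be 0, so the thickening estimate is used with a slightly
          larger positive bound, which then tends to the diameter.\<close>
        have "emeasure lborel (T i) \<le> ennreal (5 * 2 ^ DIM('a) * w * r * (D + r / real (k + 2)) ^ p)" for k
          unfolding T_def w_def p_def
        proof (rule emeasure_thickened_le)
          have "r / real (k + 2) \<le> r / 2" using r by (intro divide_left_mono) auto
          then show "D + r / real (k + 2) \<le> r" using D by linarith
          have "0 < r / real (k + 2)" using r by simp
          then show "0 < D + r / real (k + 2)" "diameter (closure (U i)) \<le> D + r / real (k + 2)"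
            using D bU by (auto simp: diameter_closure D_def)
        qed (use False bU v mT[of i] in \<open>auto simp: T_def\<close>)
        moreover have "(\<lambda>k. ennreal (5 * 2 ^ DIM('a) * w * r * (D + r / real (k + 2)) ^ p))
            \<longlonglongrightarrow> ennreal (5 * 2 ^ DIM('a) * w * r * (D + 0) ^ p)"
          using LIMSEQ_ignore_initial_segment[OF lim_const_over_n[of r], of 2]
          by (intro tendsto_ennrealI tendsto_intros) simp
        ultimately have "emeasure lborel (T i) \<le> ennreal (5 * 2 ^ DIM('a) * w * r * (D + 0) ^ p)"
          by (intro LIMSEQ_le_const) auto
        also have "\<dots> = ennreal (K * (w' * (D / 2) ^ p))"
          using w by (simp add: K_def power_divide mult.assoc)
        also have "\<dots> = ennreal K * hausdorff_weight p (U i)"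
          using False w K D by (simp add: hausdorff_weight_def ennreal_mult' w'_def D_def)
        finally show ?thesis .
      qed
    qed
    also have "\<dots> = ennreal K * (\<Sum>i. hausdorff_weight p (U i))" by (rule ennreal_suminf_cmult)
    finally have "ennreal (w * (r / 2) ^ DIM('a)) \<le> ennreal K * (\<Sum>i. hausdorff_weight p (U i))"
      using r by (simp add: emeasure_ball w_def)
    moreover have "w * (r / 2) ^ DIM('a) = K * (w' / (5 * 4 ^ DIM('a) * 2 ^ p) * r ^ p)"
    proof -
      have "r ^ DIM('a) = r * r ^ p" by (simp add: p_def power_eq_if)
      moreover have "(4::real) ^ DIM('a) = 2 ^ DIM('a) * 2 ^ DIM('a)"
        by (simp flip: power_mult_distrib)
      ultimately show ?thesis using w by (simp add: K_def power_divide)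
    qed
    ultimately have "ennreal K * ennreal (w' / (5 * 4 ^ DIM('a) * 2 ^ p) * r ^ p)
        \<le> ennreal K * (\<Sum>i. hausdorff_weight p (U i))"
      using K by (metis ennreal_mult' less_imp_le)
    then show "ennreal (w' / (5 * 4 ^ DIM('a) * 2 ^ p) * r ^ p) \<le> (\<Sum>i. hausdorff_weight p (U i))"
      using K by (subst (asm) ennreal_mult_le_mult_iff) auto
  qed
  also have "\<dots> \<le> hausdorff_outer_measure p (sphere 0 1 \<inter> cball v r)"
    using r by (intro hausdorff_premeasure_le_outer) auto
  finally show ?thesis by (simp add: p_def w'_def)
qed

lemma finite_borel_measure_on_sphere_spherical_measure:
  "finite_borel_measure_on_sphere (spherical_measure :: 'a::euclidean_space measure)"
proof -
  have "emeasure (spherical_measure :: 'a measure) (sphere 0 1) \<noteq> \<infinity>"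
    using hausdorff_outer_measure_sphere_finite[where 'a='a]
    by (subst emeasure_spherical_measure) (auto intro: closed_sphere borel_closed)
  then show ?thesis
    by (auto simp: finite_borel_measure_on_sphere_def sets_spherical_measure intro!: finite_measureI)
qed

lemma spherical_measure_cap_ge:
  obtains a :: real where "a > 0"
    "\<And>(v::'a::euclidean_space) r. norm v = 1 \<Longrightarrow> 0 < r \<Longrightarrow> r \<le> 1 \<Longrightarrow>
      a * r ^ (DIM('a) - 1) \<le> measure spherical_measure (sphere 0 1 \<inter> cball v r)"
proof
  let ?a = "unit_ball_vol (real (DIM('a) - 1)) / (5 * 4 ^ DIM('a) * 2 ^ (DIM('a) - 1))"
  show "?a > 0" by simp
  fix v :: 'a and r :: real assume "norm v = 1" "0 < r" "r \<le> 1"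
  then have "ennreal (?a * r ^ (DIM('a) - 1)) \<le> hausdorff_outer_measure (DIM('a) - 1) (sphere 0 1 \<inter> cball v r)"
    by (rule hausdorff_outer_measure_cap_ge)
  also have "\<dots> = emeasure spherical_measure (sphere 0 1 \<inter> cball v r)"
    by (subst emeasure_spherical_measure) (auto intro: borel_closed)
  finally have "ennreal (?a * r ^ (DIM('a) - 1)) \<le> emeasure spherical_measure (sphere 0 1 \<inter> cball v r)" .
  moreover have "finite_measure (spherical_measure :: 'a measure)"
    using finite_borel_measure_on_sphere_spherical_measure[where 'a='a] by (simp add: finite_borel_measure_on_sphere_def)
  ultimately show "?a * r ^ (DIM('a) - 1) \<le> measure spherical_measure (sphere 0 1 \<inter> cball v r)"
    by (simp add: finite_measure.emeasure_eq_measure ennreal_le_iff)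
qed

section \<open>Integrals over the sphere and weak convergence\<close>

lemma space_finite_borel_measure_on_sphere:
  "finite_borel_measure_on_sphere \<nu> \<Longrightarrow> space \<nu> = sphere 0 1"
  using sets_eq_imp_space_eq[of \<nu> "restrict_space borel (sphere 0 1)"]
  by (auto simp: finite_borel_measure_on_sphere_def space_restrict_space)

lemma finite_measure_finite_borel_measure_on_sphere:
  "finite_borel_measure_on_sphere \<nu> \<Longrightarrow> finite_measure \<nu>"
  by (simp add: finite_borel_measure_on_sphere_def)

lemma sets_finite_borel_measure_on_sphere:
  assumes "finite_borel_measure_on_sphere \<nu>" "A \<in> sets borel" "A \<subseteq> sphere 0 1"
  shows "A \<in> sets \<nu>"
proof -
  have "A = sphere 0 1 \<inter> A" using assms(3) by blast
  then show ?thesis using assms(1,2)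
    by (auto simp: finite_borel_measure_on_sphere_def sets_restrict_space)
qed

lemma integrable_continuous_on_sphere:
  fixes f :: "'a::euclidean_space \<Rightarrow> real"
  assumes \<nu>: "finite_borel_measure_on_sphere \<nu>" and f: "continuous_on (sphere 0 1) f"
  shows "integrable \<nu> f"
proof -
  interpret finite_measure \<nu> using \<nu> by (rule finite_measure_finite_borel_measure_on_sphere)
  have "compact (f ` sphere 0 1)" using f by (intro compact_continuous_image) auto
  then obtain B where B: "\<And>u. u \<in> sphere 0 1 \<Longrightarrow> norm (f u) \<le> B"
    by (metis bounded_iff compact_imp_bounded image_eqI)
  show ?thesis
  proof (rule integrable_const_bound)
    show "AE x in \<nu>. norm (f x) \<le> B"
      using B space_finite_borel_measure_on_sphere[OF \<nu>] by (intro AE_I2) auto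
    have "sets \<nu> = sets (restrict_space borel (sphere 0 1))"
      using \<nu> by (simp add: finite_borel_measure_on_sphere_def)
    then show "f \<in> borel_measurable \<nu>"
      using borel_measurable_continuous_on_restrict[OF f] measurable_cong_sets by blast
  qed
qed

lemma integral_mono_on_sphere:
  fixes f g :: "'a::euclidean_space \<Rightarrow> real"
  assumes \<nu>: "finite_borel_measure_on_sphere \<nu>"
    and f: "continuous_on (sphere 0 1) f" "continuous_on (sphere 0 1) g"
    and le: "\<And>u. norm u = 1 \<Longrightarrow> f u \<le> g u"
  shows "(LINT u|\<nu>. f u) \<le> (LINT u|\<nu>. g u)"
  using f \<nu> le by (intro integral_mono integrable_continuous_on_sphere)
    (auto simp: space_finite_borel_measure_on_sphere)

lemma integral_cong_on_sphere:
  fixes f g :: "'a::euclidean_space \<Rightarrow> real"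
  assumes "finite_borel_measure_on_sphere \<nu>" "\<And>u. norm u = 1 \<Longrightarrow> f u = g u"
  shows "(LINT u|\<nu>. f u) = (LINT u|\<nu>. g u)"
  using assms by (intro Bochner_Integration.integral_cong) (auto simp: space_finite_borel_measure_on_sphere)

lemma integral_const_on_sphere:
  "finite_borel_measure_on_sphere \<nu> \<Longrightarrow> (LINT u|\<nu>. (c::real)) = c * measure \<nu> (sphere 0 1)"
  by (simp add: finite_measure_finite_borel_measure_on_sphere space_finite_borel_measure_on_sphere)

lemma integral_diff_abs_le_on_sphere:
  fixes f g :: "'a::euclidean_space \<Rightarrow> real"
  assumes \<nu>: "finite_borel_measure_on_sphere \<nu>"
    and f: "continuous_on (sphere 0 1) f" "continuous_on (sphere 0 1) g"
    and le: "\<And>u. norm u = 1 \<Longrightarrow> \<bar>f u - g u\<bar> \<le> e"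
  shows "\<bar>(LINT u|\<nu>. f u) - (LINT u|\<nu>. g u)\<bar> \<le> e * measure \<nu> (sphere 0 1)"
proof -
  have "\<bar>(LINT u|\<nu>. f u) - (LINT u|\<nu>. g u)\<bar> = \<bar>LINT u|\<nu>. f u - g u\<bar>"
    using f \<nu> by (subst Bochner_Integration.integral_diff) (auto intro: integrable_continuous_on_sphere)
  also have "\<dots> \<le> (LINT u|\<nu>. \<bar>f u - g u\<bar>)" by (rule integral_abs_bound)
  also have "\<dots> \<le> (LINT u|\<nu>. e)"
    using f le by (intro integral_mono_on_sphere[OF \<nu>] continuous_intros) auto
  finally show ?thesis unfolding integral_const_on_sphere[OF \<nu>] .
qed

lemma integral_less_on_sphere:
  fixes f g :: "'a::euclidean_space \<Rightarrow> real"
  assumes \<nu>: "finite_borel_measure_on_sphere \<nu>"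
    and f: "continuous_on (sphere 0 1) f" "continuous_on (sphere 0 1) g"
    and le: "\<And>u. norm u = 1 \<Longrightarrow> f u \<le> g u"
    and A: "A \<in> sets borel" "A \<subseteq> sphere 0 1" "emeasure \<nu> A \<noteq> 0" "\<And>u. u \<in> A \<Longrightarrow> f u < g u"
  shows "(LINT u|\<nu>. f u) < (LINT u|\<nu>. g u)"
proof -
  interpret finite_measure \<nu> using \<nu> by (rule finite_measure_finite_borel_measure_on_sphere)
  have "A \<in> sets \<nu>" using \<nu> A(1,2) by (rule sets_finite_borel_measure_on_sphere)
  moreover have "AE u in \<nu>. u \<in> A \<longrightarrow> f u \<noteq> g u" using A(4) by (intro AE_I2) fastforce
  moreover have "AE u in \<nu>. f u \<le> g u"
    using le \<nu> by (intro AE_I2) (auto simp: space_finite_borel_measure_on_sphere)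
  ultimately show ?thesis
    using f \<nu> A(3) by (intro integral_less_AE[where A=A] integrable_continuous_on_sphere) auto
qed

text \<open>By continuity the strict inequality at \<open>v\<close> persists on a small cap, and
  caps have positive measure.\<close>

lemma spherical_integral_less:
  fixes f g :: "'a::euclidean_space \<Rightarrow> real"
  assumes f: "continuous_on (sphere 0 1) f" "continuous_on (sphere 0 1) g"
    and le: "\<And>u. norm u = 1 \<Longrightarrow> f u \<le> g u"
    and v: "norm v = 1" "f v < g v"
  shows "(LINT u|spherical_measure. f u) < (LINT u|spherical_measure. g u)"
proof -
  have "continuous_on (sphere 0 1) (\<lambda>u. g u - f u)" using f by (intro continuous_intros)
  then obtain d where d: "d > 0" "\<And>u. u \<in> sphere 0 1 \<Longrightarrow> dist u v < d \<Longrightarrow> dist (g u - f u) (g v - f v) < g v - f v"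
    using v unfolding continuous_on_iff by (metis diff_gt_0_iff_gt mem_sphere_0)
  define r where "r = min 1 (d / 2)"
  have r: "0 < r" "r \<le> 1" "r < d" using d by (auto simp: r_def)
  obtain a where a: "(a::real) > 0"
    "\<And>(v::'a) r. norm v = 1 \<Longrightarrow> 0 < r \<Longrightarrow> r \<le> 1 \<Longrightarrow>
      a * r ^ (DIM('a) - 1) \<le> measure spherical_measure (sphere 0 1 \<inter> cball v r)"
    by (rule spherical_measure_cap_ge) blast
  have "0 < a * r ^ (DIM('a) - 1)" using a r by simp
  also have "\<dots> \<le> measure spherical_measure (sphere 0 1 \<inter> cball v r)" using a v r by blast
  finally have "emeasure spherical_measure (sphere 0 1 \<inter> cball v r) \<noteq> 0"
    by (auto simp: measure_def)
  moreover have "f u < g u" if "u \<in> sphere 0 1 \<inter> cball v r" for u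
    using d(2)[of u] that r by (auto simp: dist_commute dist_real_def)
  ultimately show ?thesis using f le finite_borel_measure_on_sphere_spherical_measure
    by (intro integral_less_on_sphere[where A="sphere 0 1 \<inter> cball v r"]) (auto intro: borel_closed)
qed

text \<open>Makes the limit theorems for varying measures available for a fixed one, in particular
  for the spherical measure.\<close>

lemma weakly_converges_const: "weakly_converges (\<lambda>_. \<mu>) \<mu>"
  by (simp add: weakly_converges_def)

lemma weakly_converges_measure_sphere:
  assumes "weakly_converges \<mu>s \<mu>" "\<And>i. finite_borel_measure_on_sphere (\<mu>s i)"
    "finite_borel_measure_on_sphere \<mu>"
  shows "(\<lambda>i. measure (\<mu>s i) (sphere 0 1)) \<longlonglongrightarrow> measure \<mu> (sphere 0 1)"
  using assms(1)[unfolded weakly_converges_def, rule_format, OF continuous_on_const, of 1]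
  unfolding integral_const_on_sphere[OF assms(2)] integral_const_on_sphere[OF assms(3)] by simp

lemma weakly_converges_subseq:
  assumes "weakly_converges \<mu>s \<mu>" "strict_mono r"
  shows "weakly_converges (\<lambda>i. \<mu>s (r i)) \<mu>"
  unfolding weakly_converges_def
proof (intro allI impI)
  fix f :: "'a \<Rightarrow> real" assume "continuous_on (sphere 0 1) f"
  then have "(\<lambda>i. LINT u|\<mu>s i. f u) \<longlonglongrightarrow> (LINT u|\<mu>. f u)"
    using assms(1) by (simp add: weakly_converges_def)
  from LIMSEQ_subseq_LIMSEQ[OF this assms(2)]
  show "(\<lambda>i. LINT u|\<mu>s (r i). f u) \<longlonglongrightarrow> (LINT u|\<mu>. f u)" by (simp add: comp_def)
qed

text \<open>The error from replacing \<open>f i\<close> by \<open>g\<close> is at most its sup norm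
  times the mass of \<open>\<mu>s i\<close>, and these masses are eventually below
  \<open>m + 1\<close>; the fixed function \<open>g\<close> is covered by weak convergence.\<close>

lemma weakly_converges_uniform_limit:
  fixes f :: "nat \<Rightarrow> 'a::euclidean_space \<Rightarrow> real"
  assumes w: "weakly_converges \<mu>s \<mu>" and fin: "\<And>i. finite_borel_measure_on_sphere (\<mu>s i)"
    "finite_borel_measure_on_sphere \<mu>"
    and cont: "\<And>i. continuous_on (sphere 0 1) (f i)" and lim: "uniform_limit (sphere 0 1) f g sequentially"
  shows "(\<lambda>i. LINT u|\<mu>s i. f i u) \<longlonglongrightarrow> (LINT u|\<mu>. g u)"
proof -
  have g: "continuous_on (sphere 0 1) g"
    by (rule uniform_limit_theorem[OF _ lim]) (auto simp: cont)
  have "(\<lambda>i. (LINT u|\<mu>s i. f i u) - (LINT u|\<mu>s i. g u)) \<longlonglongrightarrow> 0"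
  proof (rule tendstoI)
    fix e :: real assume e: "e > 0"
    define m where "m = measure \<mu> (sphere 0 1)"
    have m: "m \<ge> 0" by (simp add: m_def)
    have "\<forall>\<^sub>F i in sequentially. measure (\<mu>s i) (sphere 0 1) < m + 1"
      using weakly_converges_measure_sphere[OF w fin] unfolding m_def by (rule order_tendstoD) simp
    moreover have "\<forall>\<^sub>F i in sequentially. \<forall>u\<in>sphere 0 1. dist (f i u) (g u) < e / (m + 1)"
      using e m by (intro uniform_limitD[OF lim]) simp
    ultimately show "\<forall>\<^sub>F i in sequentially. dist ((LINT u|\<mu>s i. f i u) - (LINT u|\<mu>s i. g u)) 0 < e"
    proof eventually_elim
      case (elim i)
      have "\<bar>(LINT u|\<mu>s i. f i u) - (LINT u|\<mu>s i. g u)\<bar> \<le> e / (m + 1) * measure (\<mu>s i) (sphere 0 1)"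
        using elim(2) by (intro integral_diff_abs_le_on_sphere fin cont g) (auto simp: dist_real_def less_imp_le)
      also have "\<dots> < e / (m + 1) * (m + 1)"
        using elim(1) e m by (intro mult_strict_left_mono) auto
      also have "\<dots> = e" using m by simp
      finally show ?case by (simp add: dist_real_def)
    qed
  qed
  moreover have "(\<lambda>i. LINT u|\<mu>s i. g u) \<longlonglongrightarrow> (LINT u|\<mu>. g u)"
    using w g by (simp add: weakly_converges_def)
  ultimately show ?thesis using tendsto_add by fastforce
qed

text \<open>Uniform continuity on the compact set \<open>{a..b} \<times> S\<close>. In the
  applications the outer function is continuous only for positive first argument, hence the common
  compact range.\<close>

lemma uniform_limit_compose_jointly_continuous:
  fixes f :: "nat \<Rightarrow> 'a::metric_space \<Rightarrow> real" and F :: "real \<times> 'a \<Rightarrow> real"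
  assumes S: "compact S" and F: "continuous_on ({a..b} \<times> S) F"
    and lim: "uniform_limit S f g sequentially"
    and ran: "\<And>i u. u \<in> S \<Longrightarrow> f i u \<in> {a..b}" "\<And>u. u \<in> S \<Longrightarrow> g u \<in> {a..b}"
  shows "uniform_limit S (\<lambda>i u. F (f i u, u)) (\<lambda>u. F (g u, u)) sequentially"
proof (rule uniform_limitI)
  fix e :: real assume e: "e > 0"
  have "uniformly_continuous_on ({a..b} \<times> S) F"
    using S F by (intro compact_uniformly_continuous compact_Times) auto
  then obtain d where d: "d > 0"
    "\<And>x y. x \<in> {a..b} \<times> S \<Longrightarrow> y \<in> {a..b} \<times> S \<Longrightarrow> dist y x < d \<Longrightarrow> dist (F y) (F x) < e"
    using e by (rule uniformly_continuous_onE) blast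
  have "\<forall>\<^sub>F i in sequentially. \<forall>u\<in>S. dist (f i u) (g u) < d" using lim d(1) by (rule uniform_limitD)
  then show "\<forall>\<^sub>F i in sequentially. \<forall>u\<in>S. dist (F (f i u, u)) (F (g u, u)) < e"
  proof eventually_elim
    case (elim i)
    show ?case
    proof
      fix u assume "u \<in> S"
      then show "dist (F (f i u, u)) (F (g u, u)) < e"
        using elim ran by (intro d(2)) (auto simp: dist_Pair_Pair)
    qed
  qed
qed

section \<open>Support and radial functions\<close>

lemma bodies_oD:
  assumes "K \<in> bodies_o"
  shows "compact K" "convex K" "0 \<in> K" "K \<noteq> {}"
  using assms interior_subset by (auto simp: bodies_o_def)

lemma support_fun_upper:
  assumes "bounded K" "x \<in> K"
  shows "x \<bullet> u \<le> support_fun K u"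
  unfolding support_fun_def
proof (rule cSUP_upper[OF assms(2)])
  obtain R where "\<And>y. y \<in> K \<Longrightarrow> norm y \<le> R" using assms(1) by (auto simp: bounded_iff)
  then show "bdd_above ((\<lambda>x. x \<bullet> u) ` K)"
    by (intro bdd_aboveI2[where M="R * norm u"]) (meson norm_cauchy_schwarz mult_right_mono norm_ge_zero order_trans)
qed

lemma support_fun_least:
  assumes "K \<noteq> {}" "\<And>x. x \<in> K \<Longrightarrow> x \<bullet> u \<le> c"
  shows "support_fun K u \<le> c"
  unfolding support_fun_def using assms by (rule cSUP_least)

lemma support_fun_lipschitz:
  assumes K: "K \<noteq> {}" and R: "\<And>x. x \<in> K \<Longrightarrow> norm x \<le> R"
  shows "\<bar>support_fun K u - support_fun K w\<bar> \<le> R * norm (u - w)"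
proof -
  have "bounded K" using R by (auto simp: bounded_iff)
  have *: "support_fun K u \<le> support_fun K w + R * norm (u - w)" for u w
  proof (rule support_fun_least[OF K])
    fix x assume x: "x \<in> K"
    have "x \<bullet> u = x \<bullet> w + x \<bullet> (u - w)" by (simp add: inner_diff_right)
    also have "x \<bullet> w \<le> support_fun K w" using \<open>bounded K\<close> x by (rule support_fun_upper)
    also have "x \<bullet> (u - w) \<le> norm x * norm (u - w)" by (rule norm_cauchy_schwarz)
    also have "\<dots> \<le> R * norm (u - w)" using R x by (intro mult_right_mono) auto
    finally show "x \<bullet> u \<le> support_fun K w + R * norm (u - w)" by simp
  qed
  show ?thesis using *[of u w] *[of w u] by (simp add: norm_minus_commute abs_le_iff)
qed

lemma support_fun_le:
  assumes K: "K \<noteq> {}" and R: "\<And>x. x \<in> K \<Longrightarrow> norm x \<le> R" and u: "norm u = 1"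
  shows "support_fun K u \<le> R"
proof (rule support_fun_least[OF K])
  fix x assume "x \<in> K"
  then show "x \<bullet> u \<le> R" using norm_cauchy_schwarz[of x u] R[of x] u by simp
qed

lemma continuous_on_support_fun:
  assumes "K \<in> bodies_o"
  shows "continuous_on A (support_fun K)"
proof -
  obtain R where R: "\<And>x. x \<in> K \<Longrightarrow> norm x \<le> R"
    using compact_imp_bounded[OF bodies_oD(1)[OF assms]] unfolding bounded_iff by blast
  have "R \<ge> 0" using R[OF bodies_oD(3)[OF assms]] by simp
  then have "R-lipschitz_on A (support_fun K)"
    using support_fun_lipschitz[OF bodies_oD(4)[OF assms] R]
    by (intro lipschitz_onI) (auto simp: dist_norm)
  then show ?thesis by (rule lipschitz_on_continuous_on)
qed

lemma support_fun_pos: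
  assumes "K \<in> bodies_o" "norm u = 1"
  shows "support_fun K u > 0"
proof -
  obtain r where r: "r > 0" "cball 0 r \<subseteq> K"
    using assms(1) unfolding bodies_o_def mem_interior_cball by auto
  then have "r *\<^sub>R u \<in> K" using assms(2) by (intro subsetD[OF r(2)]) simp
  then have "(r *\<^sub>R u) \<bullet> u \<le> support_fun K u"
    using bodies_oD(1)[OF assms(1)] compact_imp_bounded support_fun_upper by blast
  moreover have "u \<bullet> u = 1" using assms(2) by (simp add: norm_eq_1)
  ultimately show ?thesis using r by simp
qed

lemma radial_fun_polar_body:
  assumes K: "K \<in> bodies_o" and u: "norm u = 1"
  shows "radial_fun (polar_body K) u = 1 / support_fun K u"
proof -
  have pos: "support_fun K u > 0" using assms by (rule support_fun_pos)
  have bK: "bounded K" using bodies_oD(1)[OF K] by (rule compact_imp_bounded)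
  have "l *\<^sub>R u \<in> polar_body K \<longleftrightarrow> l \<le> 1 / support_fun K u" if l: "l \<ge> 0" for l
  proof
    assume *: "l *\<^sub>R u \<in> polar_body K"
    show "l \<le> 1 / support_fun K u"
    proof (cases "l = 0")
      case False
      with l have "l > 0" by simp
      have "support_fun K u \<le> 1 / l"
      proof (rule support_fun_least[OF bodies_oD(4)[OF K]])
        fix x assume "x \<in> K"
        with * have "(l *\<^sub>R u) \<bullet> x \<le> 1" by (auto simp: polar_body_def)
        then show "x \<bullet> u \<le> 1 / l" using \<open>l > 0\<close> by (simp add: field_simps inner_commute)
      qed
      then show ?thesis using pos \<open>l > 0\<close> by (simp add: field_simps)
    qed (use pos in simp)
  next
    assume "l \<le> 1 / support_fun K u"
    then have *: "l * support_fun K u \<le> 1" using pos by (simp add: field_simps)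
    have "(l *\<^sub>R u) \<bullet> x \<le> 1" if "x \<in> K" for x
      using mult_left_mono[OF support_fun_upper[OF bK that, of u] l] * by (simp add: inner_commute)
    then show "l *\<^sub>R u \<in> polar_body K" by (auto simp: polar_body_def)
  qed
  then have "{l. l \<ge> 0 \<and> l *\<^sub>R u \<in> polar_body K} = {0..1 / support_fun K u}" by auto
  then show ?thesis using pos by (simp add: radial_fun_def)
qed

lemma radial_fun_unit_ball:
  fixes u :: "'a::euclidean_space"
  assumes "norm u = 1" shows "radial_fun (cball 0 1) u = 1"
proof -
  have "{l. l \<ge> 0 \<and> l *\<^sub>R u \<in> cball 0 1} = {0..1}" using assms by auto
  then show ?thesis by (simp add: radial_fun_def)
qed

lemma unit_ball_in_bodies_o: "cball (0::'a::euclidean_space) 1 \<in> bodies_o"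
  by (simp add: bodies_o_def)

lemma support_fun_unit_ball:
  fixes u :: "'a::euclidean_space"
  assumes "norm u = 1" shows "support_fun (cball 0 1) u = 1"
proof (rule antisym)
  show "support_fun (cball 0 1) u \<le> 1" using assms by (intro support_fun_le) auto
  have "u \<bullet> u \<le> support_fun (cball 0 1) u" using assms by (intro support_fun_upper) auto
  then show "1 \<le> support_fun (cball 0 1) u" using assms by (simp add: norm_eq_1)
qed

text \<open>\<open>Q\<close> is the dilated Minkowski sum c (K + L), written as a linear image of
  the product so that compactness and convexity are inherited. It contains c K because 0 lies in
  \<open>L\<close>, which makes 0 an interior point.\<close>

lemma bodies_o_scaled_sum:
  fixes K L :: "'a::euclidean_space set"
  assumes K: "K \<in> bodies_o" and L: "L \<in> bodies_o" and c: "c > 0"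
  obtains Q where "Q \<in> bodies_o" "\<And>u. support_fun Q u = c * (support_fun K u + support_fun L u)"
proof
  define Q where "Q = (\<lambda>(x, y). c *\<^sub>R (x + y)) ` (K \<times> L)"
  have lin: "linear (\<lambda>(x::'a, y::'a). c *\<^sub>R (x + y))"
    by (rule linearI) (auto simp: algebra_simps)
  have bK: "bounded K" and bL: "bounded L"
    using bodies_oD(1) K L compact_imp_bounded by blast+
  have "compact Q" unfolding Q_def
    using bodies_oD(1)[OF K] bodies_oD(1)[OF L]
    by (intro compact_continuous_image compact_Times) (auto simp: split_def intro!: continuous_intros)
  moreover have "convex Q" unfolding Q_def
    using bodies_oD(2)[OF K] bodies_oD(2)[OF L] by (intro convex_linear_image[OF lin] convex_Times)
  moreover have "0 \<in> interior Q"
  proof -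
    obtain r where r: "r > 0" "cball 0 r \<subseteq> K"
      using K unfolding bodies_o_def mem_interior_cball by auto
    have "x \<in> Q" if "x \<in> cball 0 (c * r)" for x
    proof -
      have "(1 / c) *\<^sub>R x \<in> K" using that c by (intro subsetD[OF r(2)]) (simp add: field_simps)
      then have "(\<lambda>(x, y). c *\<^sub>R (x + y)) ((1 / c) *\<^sub>R x, 0) \<in> Q"
        unfolding Q_def using bodies_oD(3)[OF L] by (intro imageI) auto
      then show ?thesis using c by simp
    qed
    then show ?thesis using r c unfolding mem_interior_cball by (intro exI[of _ "c * r"]) auto
  qed
  ultimately show "Q \<in> bodies_o" by (simp add: bodies_o_def)
  then have bQ: "bounded Q" using bodies_oD(1) compact_imp_bounded by blast
  fix u
  show "support_fun Q u = c * (support_fun K u + support_fun L u)"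
  proof (rule antisym)
    show "support_fun Q u \<le> c * (support_fun K u + support_fun L u)"
    proof (rule support_fun_least[OF bodies_oD(4)[OF \<open>Q \<in> bodies_o\<close>]])
      fix z assume "z \<in> Q"
      then obtain x y where "x \<in> K" "y \<in> L" "z = c *\<^sub>R (x + y)" by (auto simp: Q_def)
      then show "z \<bullet> u \<le> c * (support_fun K u + support_fun L u)"
        using c bK bL by (auto simp: inner_add_left intro!: mult_left_mono add_mono support_fun_upper)
    qed
    have *: "x \<bullet> u + y \<bullet> u \<le> support_fun Q u / c" if "x \<in> K" "y \<in> L" for x y
    proof -
      have "(\<lambda>(x, y). c *\<^sub>R (x + y)) (x, y) \<in> Q" unfolding Q_def using that by (intro imageI) auto
      then have "c *\<^sub>R (x + y) \<bullet> u \<le> support_fun Q u" using bQ by (intro support_fun_upper) simp_all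
      then show ?thesis using c by (simp add: field_simps inner_add_left)
    qed
    \<comment> \<open>The suprema over \<open>K\<close> and \<open>L\<close> are taken one after the
      other, with the point of the other body fixed.\<close>
    have "support_fun K u \<le> support_fun Q u / c - y \<bullet> u" if "y \<in> L" for y
      using *[OF _ that] by (intro support_fun_least[OF bodies_oD(4)[OF K]]) (simp add: algebra_simps)
    then have "support_fun L u \<le> support_fun Q u / c - support_fun K u"
      by (intro support_fun_least[OF bodies_oD(4)[OF L]]) (simp add: algebra_simps)
    then show "c * (support_fun K u + support_fun L u) \<le> support_fun Q u"
      using c by (simp add: field_simps)
  qed
qed

text \<open>A real \<open>INF\<close> is a lower bound only for families bounded below; here 0 is
  such a bound, by positivity of \<open>\<phi>\<close> and of support functions.\<close>

lemma is_minimizer_le: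
  assumes min: "is_minimizer \<phi> \<nu> \<B> M" and Q: "Q \<in> \<B>" and \<B>: "\<B> \<subseteq> bodies_o"
    and \<nu>: "finite_borel_measure_on_sphere \<nu>" and pos: "\<And>t. t > 0 \<Longrightarrow> \<phi> t > 0"
  shows "(LINT u|\<nu>. \<phi> (support_fun M u)) \<le> (LINT u|\<nu>. \<phi> (support_fun Q u))"
proof -
  have "0 \<le> (LINT u|\<nu>. \<phi> (support_fun Q u))" if "Q \<in> \<B>" for Q
    using that \<B> pos support_fun_pos
    by (intro integral_nonneg_AE AE_I2) (force simp: space_finite_borel_measure_on_sphere[OF \<nu>] less_imp_le)
  then have "bdd_below ((\<lambda>Q. LINT u|\<nu>. \<phi> (support_fun Q u)) ` \<B>)" by (rule bdd_belowI2)
  from cINF_lower[OF this Q] min show ?thesis by (simp add: is_minimizer_def)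
qed

section \<open>A priori bounds for minimizers\<close>

text \<open>At a support function this is the dual volume of the polar body. It takes arbitrary
  functions because uniform limits and means of support functions have to be inserted without a body
  attached to them.\<close>

definition polar_vol :: "(real \<times> 'a::euclidean_space \<Rightarrow> real) \<Rightarrow> ('a \<Rightarrow> real) \<Rightarrow> real" where
  "polar_vol G f = (LINT u|spherical_measure. G (1 / f u, u))"

lemma dual_vol_polar_body:
  "Q \<in> bodies_o \<Longrightarrow> dual_vol G (polar_body Q) = polar_vol G (support_fun Q)"
  unfolding dual_vol_def polar_vol_def
  by (rule integral_cong_on_sphere[OF finite_borel_measure_on_sphere_spherical_measure])
    (simp add: radial_fun_polar_body)

lemma dual_vol_unit_ball: "dual_vol G (cball 0 1) = polar_vol G (\<lambda>_. 1)"
  unfolding dual_vol_def polar_vol_def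
  by (rule integral_cong_on_sphere[OF finite_borel_measure_on_sphere_spherical_measure])
    (simp add: radial_fun_unit_ball)

lemma B_tilde_iff:
  "Q \<in> B_tilde G \<longleftrightarrow> Q \<in> bodies_o \<and> polar_vol G (support_fun Q) = polar_vol G (\<lambda>_. 1)"
  by (auto simp: B_tilde_def dual_vol_polar_body dual_vol_unit_ball)

lemma polar_vol_cong:
  "(\<And>u. norm u = 1 \<Longrightarrow> f u = g u) \<Longrightarrow> polar_vol G f = polar_vol G g"
  unfolding polar_vol_def
  by (rule integral_cong_on_sphere[OF finite_borel_measure_on_sphere_spherical_measure]) simp

lemma unit_ball_in_B_tilde: "cball 0 1 \<in> B_tilde G"
  unfolding B_tilde_iff using unit_ball_in_bodies_o by (auto intro: polar_vol_cong support_fun_unit_ball)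

text \<open>Collects properties of \<open>G\<close> in a form stable under replacing t by t /
  \<eta>: growth is asked only from some threshold \<open>T\<close> on, because rescaling moves the
  threshold 1. The limit at 0 enters separately, as \<open>lim0\<close>, in the homogeneous
  case.\<close>

locale dual_volume_integrand =
  fixes G :: "real \<times> 'a::euclidean_space \<Rightarrow> real"
  assumes continuous: "continuous_on ({0<..} \<times> sphere 0 1) G"
    and pos: "\<And>t u. 0 < t \<Longrightarrow> norm u = 1 \<Longrightarrow> 0 < G (t, u)"
    and less: "\<And>s t u. 0 < s \<Longrightarrow> s < t \<Longrightarrow> norm u = 1 \<Longrightarrow> G (s, u) < G (t, u)"
    and convex: "\<And>u. norm u = 1 \<Longrightarrow> convex_on {0<..} (\<lambda>t. G (t, u))"
    and growth: "\<exists>c>0. \<exists>T>0. \<forall>t\<ge>T. \<forall>u. norm u = 1 \<longrightarrow> c * t ^ (DIM('a) - 1) \<le> G (t, u)"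
begin

lemma mono: "0 < s \<Longrightarrow> s \<le> t \<Longrightarrow> norm u = 1 \<Longrightarrow> G (s, u) \<le> G (t, u)"
  using less[of s t u] by (cases "s = t") auto

lemma continuous_on_integrand:
  assumes "continuous_on (sphere 0 1) f" "\<And>u. norm u = 1 \<Longrightarrow> 0 < f u"
  shows "continuous_on (sphere 0 1) (\<lambda>u. G (1 / f u, u))"
proof (rule continuous_on_compose2[OF continuous])
  show "continuous_on (sphere 0 1) (\<lambda>u. (1 / f u, u))"
    using assms by (intro continuous_intros) force+
qed (use assms in auto)

lemma polar_vol_antimono:
  assumes "continuous_on (sphere 0 1) f" "continuous_on (sphere 0 1) g"
    "\<And>u. norm u = 1 \<Longrightarrow> 0 < f u" "\<And>u. norm u = 1 \<Longrightarrow> f u \<le> g u"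
  shows "polar_vol G g \<le> polar_vol G f"
proof -
  have g: "0 < g u" if "norm u = 1" for u using assms(3,4)[OF that] by linarith
  show ?thesis unfolding polar_vol_def
    using assms g by (intro integral_mono_on_sphere[OF finite_borel_measure_on_sphere_spherical_measure]
      continuous_on_integrand mono) (auto simp: frac_le)
qed

lemma polar_vol_limit:
  assumes lim: "uniform_limit (sphere 0 1) f g sequentially"
    and cont: "\<And>i. continuous_on (sphere 0 1) (f i)"
    and a: "0 < a" and bounds: "\<And>i u. norm u = 1 \<Longrightarrow> f i u \<in> {a..b}" "\<And>u. norm u = 1 \<Longrightarrow> g u \<in> {a..b}"
  shows "(\<lambda>i. polar_vol G (f i)) \<longlonglongrightarrow> polar_vol G g"
  unfolding polar_vol_def
proof (rule weakly_converges_uniform_limit[OF weakly_converges_const])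
  have "continuous_on ({a..b} \<times> sphere 0 1) (\<lambda>p. G (1 / fst p, snd p))"
    using a by (intro continuous_on_compose2[OF continuous] continuous_intros) auto
  from uniform_limit_compose_jointly_continuous[OF _ this lim] bounds
  show "uniform_limit (sphere 0 1) (\<lambda>i u. G (1 / f i u, u)) (\<lambda>u. G (1 / g u, u)) sequentially"
    by simp
  fix i
  show "continuous_on (sphere 0 1) (\<lambda>u. G (1 / f i u, u))"
    using bounds(1) a by (intro continuous_on_integrand cont) (force intro: order.strict_trans2)
qed (rule finite_borel_measure_on_sphere_spherical_measure)+

end

section \<open>Lower bound for support functions from a bound on the dual volume\<close>

text \<open>A point lying in several nested caps collects the weights of all of them; up to a factor
  2 only the finest one counts.\<close>

lemma sum_power_le_twice_last:
  fixes x :: real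
  assumes "2 \<le> x" "K \<subseteq> {..j}"
  shows "(\<Sum>k\<in>K. x ^ k) \<le> 2 * x ^ j"
proof -
  have "(\<Sum>k\<le>j. x ^ k) \<le> 2 * x ^ j" for j
  proof (induction j)
    case (Suc j)
    have "2 * x ^ j \<le> x ^ Suc j" using assms(1) by (simp add: mult_right_mono)
    with Suc show ?case by simp
  qed simp
  moreover have "(\<Sum>k\<in>K. x ^ k) \<le> (\<Sum>k\<le>j. x ^ k)" using assms by (intro sum_mono2) auto
  ultimately show ?thesis by (meson order_trans)
qed

text \<open>
  If \<open>h_Q\<close> is at most \<open>R / 2^m\<close> at \<open>v\<close>, then on the cap of radius \<open>1 / 2^k\<close>, \<open>k \<le> m\<close>, around \<open>v\<close>
  the integrand is at least a constant times \<open>2^(k(n - 1))\<close>, the inverse order of the measure of the cap;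
  hence each dyadic scale contributes at least a fixed amount to the dual volume.
\<close>
lemma (in dual_volume_integrand) support_fun_lower_bound:
  assumes dim: "2 \<le> DIM('a)" and R: "0 < R"
  obtains \<delta> where "0 < \<delta>" "\<And>Q u. Q \<in> bodies_o \<Longrightarrow> (\<And>x. x \<in> Q \<Longrightarrow> norm x \<le> R) \<Longrightarrow>
    polar_vol G (support_fun Q) \<le> V \<Longrightarrow> norm u = 1 \<Longrightarrow> \<delta> \<le> support_fun Q u"
proof -
  define p where "p = DIM('a) - 1"
  have p: "p \<ge> 1" using dim by (simp add: p_def)
  obtain c T where c: "c > 0" "T > 0" and cT: "\<And>t u. t \<ge> T \<Longrightarrow> norm u = 1 \<Longrightarrow> c * t ^ p \<le> G (t, u)"
    using growth unfolding p_def by blast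
  obtain a where a: "(a::real) > 0"
    "\<And>(v::'a) r. norm v = 1 \<Longrightarrow> 0 < r \<Longrightarrow> r \<le> 1 \<Longrightarrow>
      a * r ^ p \<le> measure spherical_measure (sphere 0 1 \<inter> cball v r)"
    unfolding p_def by (rule spherical_measure_cap_ge) blast
  \<comment> \<open>At scale k the support function is at most 2R / 2^k on the cap, so the growth of
    \<open>G\<close> gives the lower bound c (2^k / (2R))^p, which is c' 2^(kp).\<close>
  define c' where "c' = c / (2 * R) ^ p"
  have c': "c' > 0" using c R by (simp add: c'_def)
  \<comment> \<open>From \<open>k0\<close> on the arguments 2^k / (2R) lie beyond the threshold
    \<open>T\<close>.\<close>
  obtain k0 :: nat where k0: "2 * R * T < 2 ^ k0"
    using real_arch_pow[of 2 "2 * R * T"] by auto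
  \<comment> \<open>Each scale contributes at least c' a / 2, so N + 1 scales contribute more than
    \<open>V\<close>.\<close>
  obtain N :: nat where N: "2 * V / (c' * a) < real N" using reals_Archimedean2 by blast
  define m where "m = k0 + N"
  define \<delta> where "\<delta> = R / 2 ^ m"
  have "\<delta> \<le> support_fun Q v" if Q: "Q \<in> bodies_o" "\<And>x. x \<in> Q \<Longrightarrow> norm x \<le> R"
    "polar_vol G (support_fun Q) \<le> V" and v: "norm v = 1" for Q v
  proof (rule ccontr)
    let ?h = "support_fun Q"
    assume "\<not> ?thesis"
    then have hv: "?h v < R / 2 ^ m" by (simp add: \<delta>_def)
    define A where "A k = sphere 0 1 \<inter> cball v (1 / 2 ^ k)" for k :: nat
    define x :: real where "x = 2 ^ p"
    have x: "x \<ge> 2" using power_increasing[OF p, of "2::real"] by (simp add: x_def)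
    have hpos: "?h u > 0" if "norm u = 1" for u using Q(1) that by (rule support_fun_pos)
    have cap: "c' * x ^ k \<le> G (1 / ?h u, u)" if k: "k \<in> {k0..m}" and u: "u \<in> A k" for k u
    proof -
      have u1: "norm u = 1" and uv: "norm (u - v) \<le> 1 / 2 ^ k"
        using u by (auto simp: A_def dist_norm norm_minus_commute)
      have "?h u \<le> ?h v + R * norm (u - v)"
        using support_fun_lipschitz[OF bodies_oD(4)[OF Q(1)] Q(2), of u v] by linarith
      also have "\<dots> \<le> R / 2 ^ m + R * (1 / 2 ^ k)"
        using hv uv R by (intro add_mono mult_left_mono) auto
      also have "\<dots> \<le> R / 2 ^ k + R / 2 ^ k"
        using k R by (intro add_mono divide_left_mono power_increasing) auto
      finally have hu: "?h u \<le> 2 * R / 2 ^ k" by simp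
      have "(2::real) ^ k0 \<le> 2 ^ k" using k by (intro power_increasing) auto
      then have "2 * R * T \<le> 2 ^ k" using k0 by linarith
      then have T: "T \<le> 2 ^ k / (2 * R)" using R by (simp add: field_simps)
      have t: "2 ^ k / (2 * R) \<le> 1 / ?h u" using hu hpos[OF u1] R by (simp add: field_simps)
      have "c' * x ^ k = c * (2 ^ k / (2 * R)) ^ p"
        by (simp add: c'_def x_def power_divide power_mult[symmetric] mult.commute)
      also have "\<dots> \<le> G (2 ^ k / (2 * R), u)" using T u1 by (rule cT)
      also have "\<dots> \<le> G (1 / ?h u, u)" using t u1 R by (intro mono) auto
      finally show ?thesis .
    qed
    \<comment> \<open>Only the finest cap containing \<open>u\<close> is compared with the
      integrand; halving \<open>c'\<close> pays for the geometric sum over the coarser ones.\<close>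
    have bound: "c' / 2 * (\<Sum>k=k0..m. x ^ k * indicator (A k) u) \<le> G (1 / ?h u, u)" if u: "norm u = 1" for u
    proof -
      define K where "K = {k \<in> {k0..m}. u \<in> A k}"
      have sum: "(\<Sum>k=k0..m. x ^ k * indicator (A k) u) = (\<Sum>k\<in>K. x ^ k)"
        unfolding K_def by (rule sum.mono_neutral_cong_right) (auto simp: indicator_def)
      show ?thesis
      proof (cases "K = {}")
        case True
        then show ?thesis using pos[of "1 / ?h u" u] hpos u by (simp add: sum less_imp_le)
      next
        case False
        have "finite K" by (simp add: K_def)
        define j where "j = Max K"
        have j: "j \<in> K" using \<open>finite K\<close> False by (simp add: j_def)
        have "K \<subseteq> {..j}" using \<open>finite K\<close> by (auto simp: j_def)
        then have "(\<Sum>k\<in>K. x ^ k) \<le> 2 * x ^ j" using x by (rule sum_power_le_twice_last[rotated])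
        then have "c' / 2 * (\<Sum>k\<in>K. x ^ k) \<le> c' / 2 * (2 * x ^ j)"
          using c' by (intro mult_left_mono) auto
        also have "\<dots> \<le> G (1 / ?h u, u)" using cap[of j u] j by (simp add: K_def)
        finally show ?thesis by (simp add: sum)
      qed
    qed
    have fin: "finite_measure (spherical_measure :: 'a measure)"
      by (rule finite_measure_finite_borel_measure_on_sphere[OF finite_borel_measure_on_sphere_spherical_measure])
    have mA: "A k \<in> sets spherical_measure" for k
      by (rule sets_finite_borel_measure_on_sphere[OF finite_borel_measure_on_sphere_spherical_measure])
        (auto simp: A_def intro: borel_closed)
    have iA: "integrable spherical_measure (\<lambda>u. x ^ k * indicator (A k) u)" for k
      using mA[of k] by (intro integrable_mult_right integrable_real_indicator)
        (auto simp: finite_measure.emeasure_finite[OF fin] less_top[symmetric])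
    have "c' / 2 * (real (Suc N) * a) = c' / 2 * (\<Sum>k=k0..m. a)" by (simp add: m_def)
    also have "\<dots> \<le> c' / 2 * (\<Sum>k=k0..m. x ^ k * measure spherical_measure (A k))"
    proof (intro mult_left_mono sum_mono)
      fix k
      have "a * (1 / 2 ^ k) ^ p \<le> measure spherical_measure (A k)"
        unfolding A_def using v by (intro a(2)) auto
      then have "x ^ k * (a * (1 / 2 ^ k) ^ p) \<le> x ^ k * measure spherical_measure (A k)"
        using x by (intro mult_left_mono) auto
      moreover have "x ^ k * (a * (1 / 2 ^ k) ^ p) = a"
        by (simp add: x_def power_divide power_mult[symmetric] mult.commute)
      ultimately show "a \<le> x ^ k * measure spherical_measure (A k)" by simp
    qed (use c' in auto)
    also have "(\<Sum>k=k0..m. x ^ k * measure spherical_measure (A k))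
        = (\<Sum>k=k0..m. LINT u|spherical_measure. x ^ k * indicator (A k) u)"
      using mA by (intro sum.cong refl) (simp add: sets.Int_space_eq2 del: space_spherical_measure)
    also have "\<dots> = (LINT u|spherical_measure. (\<Sum>k=k0..m. x ^ k * indicator (A k) u))"
      using iA by (rule Bochner_Integration.integral_sum[symmetric])
    also have "c' / 2 * \<dots> = (LINT u|spherical_measure. c' / 2 * (\<Sum>k=k0..m. x ^ k * indicator (A k) u))"
      by (rule integral_mult_right_zero[symmetric])
    also have "\<dots> \<le> (LINT u|spherical_measure. G (1 / ?h u, u))"
    proof (rule integral_mono)
      show "integrable spherical_measure (\<lambda>u. c' / 2 * (\<Sum>k=k0..m. x ^ k * indicator (A k) u))"
        by (intro integrable_mult_right Bochner_Integration.integrable_sum iA)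
      show "integrable spherical_measure (\<lambda>u. G (1 / ?h u, u))"
        using hpos by (intro integrable_continuous_on_sphere[OF finite_borel_measure_on_sphere_spherical_measure]
          continuous_on_integrand continuous_on_support_fun Q(1))
    qed (use bound in auto)
    also have "\<dots> \<le> V" using Q(3) by (simp add: polar_vol_def)
    finally have "c' / 2 * (real (Suc N) * a) \<le> V" .
    then have "real (Suc N) \<le> 2 * V / (c' * a)" using c' a by (simp add: field_simps)
    with N show False by simp
  qed
  moreover have "\<delta> > 0" using R by (simp add: \<delta>_def)
  ultimately show ?thesis using that by blast
qed

section \<open>Upper bound for minimizers\<close>

lemma not_conc_integral_pos_part_pos:
  assumes \<mu>: "finite_borel_measure_on_sphere \<mu>" "not_conc_on_closed_hemisphere \<mu>" and v: "norm v = 1"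
  shows "0 < (LINT u|\<mu>. max 0 (u \<bullet> v))"
proof -
  have "(LINT u|\<mu>. 0) < (LINT u|\<mu>. max 0 (u \<bullet> v))"
  proof (rule integral_less_on_sphere[OF \<mu>(1)])
    show "{u \<in> sphere 0 1. u \<bullet> v > 0} \<in> sets borel"
    proof -
      have "{u \<in> sphere 0 1. u \<bullet> v > 0} = sphere 0 1 \<inter> {u. v \<bullet> u > 0}" by (auto simp: inner_commute)
      then show ?thesis by (simp add: borel_open open_halfspace_gt)
    qed
    show "emeasure \<mu> {u \<in> sphere 0 1. u \<bullet> v > 0} \<noteq> 0"
      using \<mu>(2)[unfolded not_conc_on_closed_hemisphere_def, rule_format, of v] v by auto
  qed (auto intro!: continuous_intros)
  then show ?thesis by simp
qed

lemma integral_pos_part_diff_le: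
  fixes v w :: "'a::euclidean_space"
  assumes \<mu>: "finite_borel_measure_on_sphere \<mu>"
  shows "\<bar>(LINT u|\<mu>. max 0 (u \<bullet> v)) - (LINT u|\<mu>. max 0 (u \<bullet> w))\<bar> \<le> norm (v - w) * measure \<mu> (sphere 0 1)"
proof (rule integral_diff_abs_le_on_sphere[OF \<mu>])
  fix u :: 'a assume "norm u = 1"
  then have "\<bar>u \<bullet> (v - w)\<bar> \<le> norm (v - w)" using Cauchy_Schwarz_ineq2[of u "v - w"] by simp
  then show "\<bar>max 0 (u \<bullet> v) - max 0 (u \<bullet> w)\<bar> \<le> norm (v - w)"
    by (simp add: inner_diff_right max_def abs_le_iff split: if_splits)
qed (auto intro!: continuous_intros)

text \<open>For \<open>\<mu>\<close> the integral is positive and continuous in the direction, so it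
  has a positive minimum, called 2c. Weak convergence acts on one direction at a time; a finite net
  and a Lipschitz constant valid for all late \<open>\<mu>s i\<close> carry the estimate to all
  directions. One c / 2 is lost to the convergence and one to the net.\<close>

lemma weakly_converges_integral_pos_part_lower_bound:
  fixes \<mu> :: "'a::euclidean_space measure"
  assumes w: "weakly_converges \<mu>s \<mu>" and \<mu>s: "\<And>i. finite_borel_measure_on_sphere (\<mu>s i)"
    and \<mu>: "finite_borel_measure_on_sphere \<mu>" "not_conc_on_closed_hemisphere \<mu>"
  obtains c where "0 < c"
    "\<forall>\<^sub>F i in sequentially. \<forall>v. norm v = 1 \<longrightarrow> c \<le> (LINT u|\<mu>s i. max 0 (u \<bullet> v))"
proof -
  define g where "g \<nu> v = (LINT u|\<nu>. max 0 (u \<bullet> v))" for \<nu> and v :: 'a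
  define m where "m = measure \<mu> (sphere 0 1)"
  have m: "m \<ge> 0" by (simp add: m_def)
  have "m-lipschitz_on (sphere 0 1) (g \<mu>)"
    using integral_pos_part_diff_le[OF \<mu>(1)] m
    by (intro lipschitz_onI) (auto simp: g_def m_def dist_norm mult.commute)
  then have "continuous_on (sphere 0 1) (g \<mu>)" by (rule lipschitz_on_continuous_on)
  then obtain v0 where v0: "v0 \<in> sphere 0 1" "\<And>v. v \<in> sphere 0 1 \<Longrightarrow> g \<mu> v0 \<le> g \<mu> v"
    using continuous_attains_inf[of "sphere 0 1" "g \<mu>"] by auto
  define c where "c = g \<mu> v0 / 2"
  have c: "c > 0" using not_conc_integral_pos_part_pos[OF \<mu>, of v0] v0 by (simp add: c_def g_def)
  define e where "e = (c / 2) / (m + 1)"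
  have e: "e > 0" using c m by (simp add: e_def)
  obtain V where V: "V \<subseteq> sphere (0::'a) 1" "finite V" "sphere 0 1 \<subseteq> (\<Union>v\<in>V. ball v e)"
    using e by (rule_tac compactE_image[OF compact_sphere[of "0::'a" 1], of "sphere 0 1" "\<lambda>v. ball v e"])
      (auto intro: that)
  have "\<forall>\<^sub>F i in sequentially. \<forall>v\<in>V. 3 / 2 * c < g (\<mu>s i) v"
  proof (rule eventually_ball_finite[OF V(2)], rule)
    fix v assume "v \<in> V"
    then have "2 * c \<le> g \<mu> v" using v0(2)[of v] V(1) by (auto simp: c_def)
    then have "3 / 2 * c < g \<mu> v" using c by linarith
    moreover have "(\<lambda>i. g (\<mu>s i) v) \<longlonglongrightarrow> g \<mu> v"
      unfolding g_def using w[unfolded weakly_converges_def, rule_format, of "\<lambda>u. max 0 (u \<bullet> v)"]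
      by (simp add: continuous_intros)
    ultimately show "\<forall>\<^sub>F i in sequentially. 3 / 2 * c < g (\<mu>s i) v" by (rule order_tendstoD(1)[rotated])
  qed
  moreover have "\<forall>\<^sub>F i in sequentially. measure (\<mu>s i) (sphere 0 1) < m + 1"
    using weakly_converges_measure_sphere[OF w \<mu>s \<mu>(1)] unfolding m_def by (rule order_tendstoD) simp
  ultimately have "\<forall>\<^sub>F i in sequentially. \<forall>v. norm v = 1 \<longrightarrow> c \<le> g (\<mu>s i) v"
  proof eventually_elim
    case (elim i)
    show ?case
    proof (intro allI impI)
      fix v :: 'a assume "norm v = 1"
      then obtain v' where v': "v' \<in> V" "dist v' v < e" using V(3) by force
      have "\<bar>g (\<mu>s i) v' - g (\<mu>s i) v\<bar> \<le> norm (v' - v) * measure (\<mu>s i) (sphere 0 1)"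
        unfolding g_def by (rule integral_pos_part_diff_le[OF \<mu>s])
      also have "\<dots> \<le> e * (m + 1)"
        using v'(2) elim(2) e by (intro mult_mono) (auto simp: dist_norm)
      also have "\<dots> = c / 2" using m unfolding e_def by (subst nonzero_eq_divide_eq[symmetric]) auto
      finally have "g (\<mu>s i) v' - c / 2 \<le> g (\<mu>s i) v" by linarith
      moreover have "3 / 2 * c < g (\<mu>s i) v'" using elim(1) v'(1) by blast
      ultimately show "c \<le> g (\<mu>s i) v" by linarith
    qed
  qed
  then show ?thesis using that[OF c] by (simp add: g_def)
qed

text \<open>\<open>\<alpha>\<close> is the slope of the secant of \<open>\<phi>\<close> over
  [1/2, 1]. Beyond 1 the convex function stays above this secant line, and up to 1 the linear bound
  is at most 0.\<close>

lemma convex_increasing_linear_lower_bound: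
  fixes \<phi> :: "real \<Rightarrow> real"
  assumes conv: "convex_on {0<..} \<phi>" and mono: "strict_mono_on {0<..} \<phi>"
    and pos: "\<And>t. 0 < t \<Longrightarrow> 0 < \<phi> t"
  obtains \<alpha> where "0 < \<alpha>" "\<And>t. 0 < t \<Longrightarrow> \<alpha> * (t - 1) \<le> \<phi> t"
proof
  let ?\<alpha> = "(\<phi> 1 - \<phi> (1 / 2)) / (1 - 1 / 2)"
  have "\<phi> (1 / 2) < \<phi> 1" using mono by (rule strict_mono_onD) auto
  then show \<alpha>: "?\<alpha> > 0" by simp
  fix t :: real assume t: "t > 0"
  show "?\<alpha> * (t - 1) \<le> \<phi> t"
  proof (cases "t \<le> 1")
    case True
    then have "?\<alpha> * (t - 1) \<le> 0" using \<alpha> by (intro mult_nonneg_nonpos) auto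
    then show ?thesis using pos[OF t] by linarith
  next
    case False
    \<comment> \<open>The weight for which 1 is the convex combination (1 - s) t + s / 2 of t and 1
      / 2.\<close>
    define s where "s = (t - 1) / (t - 1 / 2)"
    have s: "0 \<le> s" "s \<le> 1" using False by (auto simp: s_def)
    have "\<phi> ((1 - s) *\<^sub>R t + s *\<^sub>R (1 / 2)) \<le> (1 - s) * \<phi> t + s * \<phi> (1 / 2)"
      using conv s t by (intro convex_onD) auto
    moreover have sD: "s * (t - 1 / 2) = t - 1" using False by (simp add: s_def)
    then have "(1 - s) *\<^sub>R t + s *\<^sub>R (1 / 2) = 1" by (simp add: algebra_simps)
    ultimately have "\<phi> 1 \<le> (1 - s) * \<phi> t + s * \<phi> (1 / 2)" by simp
    then have "\<phi> 1 * (t - 1 / 2) \<le> ((1 - s) * \<phi> t + s * \<phi> (1 / 2)) * (t - 1 / 2)"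
      using False by (intro mult_right_mono) auto
    also have "\<dots> = (t - 1 / 2 - s * (t - 1 / 2)) * \<phi> t + (s * (t - 1 / 2)) * \<phi> (1 / 2)"
      by (simp add: algebra_simps)
    also have "\<dots> = \<phi> t / 2 + (t - 1) * \<phi> (1 / 2)" by (simp add: sD)
    finally show ?thesis using pos[of 1] by (simp add: algebra_simps)
  qed
qed

lemma class_I_D:
  assumes "\<phi> \<in> class_I"
  shows "continuous_on {0<..} \<phi>" "strict_mono_on {0<..} \<phi>" "\<And>t. 0 < t \<Longrightarrow> 0 < \<phi> t" "\<phi> 1 = 1"
  using assms by (auto simp: class_I_def)

text \<open>A point \<open>x\<close> of \<open>Ms i\<close> in direction \<open>v\<close> forces the
  support function at \<open>u\<close> to be at least norm x times the positive part of u . v, so by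
  linear growth the functional is at least \<open>\<alpha>\<close> (c norm x - mass). The unit ball
  competes with a value equal to the mass, since \<open>\<phi> 1 = 1\<close>. Solving for norm x,
  with the eventual bound m + 1 for the mass, gives \<open>R\<close>.\<close>

lemma minimizers_bounded:
  fixes \<mu> :: "'a::euclidean_space measure"
  assumes w: "weakly_converges \<mu>s \<mu>" and \<mu>s: "\<And>i. finite_borel_measure_on_sphere (\<mu>s i)"
    and \<mu>: "finite_borel_measure_on_sphere \<mu>" "not_conc_on_closed_hemisphere \<mu>"
    and conv: "convex_on {0<..} \<phi>" and \<phi>: "\<phi> \<in> class_I"
    and min: "\<And>i. is_minimizer \<phi> (\<mu>s i) (B_tilde G) (Ms i)"
  obtains R where "0 < R" "\<forall>\<^sub>F i in sequentially. \<forall>x\<in>Ms i. norm x \<le> R"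
proof -
  note \<phi>' = class_I_D[OF \<phi>]
  obtain \<alpha> where \<alpha>: "0 < \<alpha>" "\<And>t. 0 < t \<Longrightarrow> \<alpha> * (t - 1) \<le> \<phi> t"
    using convex_increasing_linear_lower_bound[OF conv \<phi>'(2,3)] by blast
  obtain c where c: "0 < c" "\<forall>\<^sub>F i in sequentially. \<forall>v. norm v = 1 \<longrightarrow> c \<le> (LINT u|\<mu>s i. max 0 (u \<bullet> v))"
    using weakly_converges_integral_pos_part_lower_bound[OF w \<mu>s \<mu>] by blast
  define m where "m = measure \<mu> (sphere 0 1)"
  have m: "m \<ge> 0" by (simp add: m_def)
  define R where "R = (1 + \<alpha>) * (m + 1) / (\<alpha> * c)"
  have R: "R > 0" using \<alpha> c m by (simp add: R_def)
  have Ms: "Ms i \<in> bodies_o" for i using min[of i] by (auto simp: is_minimizer_def B_tilde_def)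
  have "\<forall>\<^sub>F i in sequentially. measure (\<mu>s i) (sphere 0 1) < m + 1"
    using weakly_converges_measure_sphere[OF w \<mu>s \<mu>(1)] unfolding m_def by (rule order_tendstoD) simp
  with c(2) have "\<forall>\<^sub>F i in sequentially. \<forall>x\<in>Ms i. norm x \<le> R"
  proof eventually_elim
    case (elim i)
    show ?case
    proof
      fix x assume x: "x \<in> Ms i"
      show "norm x \<le> R"
      proof (cases "x = 0")
        case False
        define v where "v = x /\<^sub>R norm x"
        have v: "norm v = 1" "x = norm x *\<^sub>R v" using False by (auto simp: v_def)
        have h: "0 < support_fun (Ms i) u" if "norm u = 1" for u using Ms that by (rule support_fun_pos)
        have cont: "continuous_on (sphere 0 1) (\<lambda>u. \<phi> (support_fun (Ms i) u))"
          using h by (intro continuous_on_compose2[OF \<phi>'(1)] continuous_on_support_fun Ms) auto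
        have "norm x * max 0 (u \<bullet> v) \<le> support_fun (Ms i) u" if u: "norm u = 1" for u
        proof -
          have "x \<bullet> u \<le> support_fun (Ms i) u"
            using bodies_oD(1)[OF Ms] compact_imp_bounded x by (blast intro: support_fun_upper)
          moreover have "x \<bullet> u = norm x * (u \<bullet> v)" by (subst v(2)) (simp add: inner_commute)
          ultimately show ?thesis using h[OF u] by (auto simp: max_def)
        qed
        then have ge: "\<alpha> * (norm x * max 0 (u \<bullet> v) - 1) \<le> \<phi> (support_fun (Ms i) u)" if "norm u = 1" for u
          using \<alpha> h that by (intro order_trans[OF _ \<alpha>(2)]) auto
        have "\<alpha> * norm x * c - \<alpha> * (m + 1)
            \<le> \<alpha> * norm x * (LINT u|\<mu>s i. max 0 (u \<bullet> v)) - \<alpha> * measure (\<mu>s i) (sphere 0 1)"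
          using elim v(1) \<alpha> by (intro diff_mono mult_left_mono) auto
        also have "\<dots> = (LINT u|\<mu>s i. \<alpha> * norm x * max 0 (u \<bullet> v)) - (LINT u|\<mu>s i. \<alpha>)"
          unfolding integral_const_on_sphere[OF \<mu>s] by simp
        also have "\<dots> = (LINT u|\<mu>s i. \<alpha> * norm x * max 0 (u \<bullet> v) - \<alpha>)"
          by (rule Bochner_Integration.integral_diff[symmetric])
            (auto intro!: integrable_continuous_on_sphere[OF \<mu>s] continuous_intros)
        also have "\<dots> \<le> (LINT u|\<mu>s i. \<phi> (support_fun (Ms i) u))"
          using ge by (intro integral_mono_on_sphere[OF \<mu>s] cont continuous_intros) (auto simp: algebra_simps)
        also have "\<dots> \<le> (LINT u|\<mu>s i. \<phi> (support_fun (cball 0 1) u))"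
          using min \<phi>'(3) by (intro is_minimizer_le[OF _ unit_ball_in_B_tilde _ \<mu>s]) (auto simp: B_tilde_def)
        also have "\<dots> = (LINT u|\<mu>s i. 1)"
          by (rule integral_cong_on_sphere[OF \<mu>s]) (simp add: support_fun_unit_ball \<phi>'(4))
        also have "\<dots> \<le> m + 1" using elim(2) unfolding integral_const_on_sphere[OF \<mu>s] by simp
        finally have "\<alpha> * norm x * c \<le> (1 + \<alpha>) * (m + 1)" by (simp add: algebra_simps)
        then show ?thesis using \<alpha> c by (simp add: R_def field_simps)
      qed (use R in simp)
    qed
  qed
  then show ?thesis using that[OF R] by blast
qed

section \<open>Uniqueness and convergence\<close>

lemma harmonic_le_arithmetic:
  fixes a b :: real
  assumes "0 < a" "0 < b"
  shows "1 / ((a + b) / 2) \<le> (1 / a + 1 / b) / 2"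
    and "a \<noteq> b \<Longrightarrow> 1 / ((a + b) / 2) < (1 / a + 1 / b) / 2"
proof -
  have eq: "(1 / a + 1 / b) / 2 - 1 / ((a + b) / 2) = (a - b)\<^sup>2 / (2 * a * b * (a + b))"
    using assms by (simp add: field_simps power2_eq_square add_pos_pos add_eq_0_iff)
  show "1 / ((a + b) / 2) \<le> (1 / a + 1 / b) / 2"
    using eq assms by (smt (verit) divide_nonneg_pos mult_pos_pos zero_le_power2)
  assume "a \<noteq> b"
  then have "(a - b)\<^sup>2 / (2 * a * b * (a + b)) > 0" using assms by (intro divide_pos_pos) auto
  then show "1 / ((a + b) / 2) < (1 / a + 1 / b) / 2" using eq by linarith
qed

lemma continuous_on_sphere_bounds:
  fixes f :: "'a::euclidean_space \<Rightarrow> real"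
  assumes f: "continuous_on (sphere 0 1) f" and pos: "\<And>u. norm u = 1 \<Longrightarrow> 0 < f u"
  obtains a b where "0 < a" "a \<le> b" "\<And>u. norm u = 1 \<Longrightarrow> f u \<in> {a..b}"
proof -
  obtain e :: 'a where "e \<in> Basis" using nonempty_Basis by blast
  then have e: "e \<in> sphere 0 1" by (simp add: norm_Basis)
  then have ne: "sphere (0::'a) 1 \<noteq> {}" by blast
  obtain p where p: "p \<in> sphere 0 1" "\<And>u. u \<in> sphere 0 1 \<Longrightarrow> f p \<le> f u"
    using continuous_attains_inf[OF compact_sphere ne f] by blast
  obtain q where q: "q \<in> sphere 0 1" "\<And>u. u \<in> sphere 0 1 \<Longrightarrow> f u \<le> f q"
    using continuous_attains_sup[OF compact_sphere ne f] by blast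
  show ?thesis using that[of "f p" "f q"] p q pos by auto
qed

lemma weakly_converges_compose:
  fixes f :: "nat \<Rightarrow> 'a::euclidean_space \<Rightarrow> real" and \<phi> :: "real \<Rightarrow> real"
  assumes w: "weakly_converges \<mu>s \<mu>" and fin: "\<And>i. finite_borel_measure_on_sphere (\<mu>s i)"
    "finite_borel_measure_on_sphere \<mu>"
    and \<phi>: "continuous_on {0<..} \<phi>"
    and lim: "uniform_limit (sphere 0 1) f g sequentially"
    and cont: "\<And>i. continuous_on (sphere 0 1) (f i)"
    and a: "0 < a" and bounds: "\<And>i u. norm u = 1 \<Longrightarrow> f i u \<in> {a..b}" "\<And>u. norm u = 1 \<Longrightarrow> g u \<in> {a..b}"
  shows "(\<lambda>i. LINT u|\<mu>s i. \<phi> (f i u)) \<longlonglongrightarrow> (LINT u|\<mu>. \<phi> (g u))"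
proof (rule weakly_converges_uniform_limit[OF w fin])
  have "continuous_on ({a..b} \<times> sphere (0::'a) 1) (\<lambda>p. \<phi> (fst p))"
    using a by (intro continuous_on_compose2[OF \<phi>] continuous_intros) auto
  from uniform_limit_compose_jointly_continuous[OF _ this lim] bounds
  show "uniform_limit (sphere 0 1) (\<lambda>i u. \<phi> (f i u)) (\<lambda>u. \<phi> (g u)) sequentially" by simp
  show "continuous_on (sphere 0 1) (\<lambda>u. \<phi> (f i u))" for i
    using bounds(1) a by (intro continuous_on_compose2[OF \<phi> cont]) (force intro: order.strict_trans2)
qed

context dual_volume_integrand
begin

text \<open>Convexity in t compares \<open>G\<close> at the mean of the reciprocals with the mean of
  the values. The strict gain is that the reciprocal of the mean of two different numbers lies below
  the mean of their reciprocals, and \<open>G\<close> is strictly increasing.\<close>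

lemma polar_vol_average_less:
  assumes f: "continuous_on (sphere 0 1) f" "\<And>u. norm u = 1 \<Longrightarrow> 0 < f u"
    and g: "continuous_on (sphere 0 1) g" "\<And>u. norm u = 1 \<Longrightarrow> 0 < g u"
    and v: "norm v = 1" "f v \<noteq> g v"
  shows "polar_vol G (\<lambda>u. (f u + g u) / 2) < (polar_vol G f + polar_vol G g) / 2"
proof -
  note fin = finite_borel_measure_on_sphere_spherical_measure
  define H where "H u = (G (1 / f u, u) + G (1 / g u, u)) / 2" for u
  have conv: "G ((1 / f u + 1 / g u) / 2, u) \<le> H u" if u: "norm u = 1" for u
    using convex_onD[OF convex[OF u], of "1 / 2" "1 / f u" "1 / g u"] f(2)[OF u] g(2)[OF u]
    by (simp add: H_def add_divide_distrib mult.commute)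
  have le: "G (1 / ((f u + g u) / 2), u) \<le> H u" if u: "norm u = 1" for u
    using mono[OF _ harmonic_le_arithmetic(1)[OF f(2) g(2)], OF _ u u u] f(2)[OF u] g(2)[OF u] conv[OF u]
    by (simp add: add_pos_pos)
  have "G (1 / ((f v + g v) / 2), v) < G ((1 / f v + 1 / g v) / 2, v)"
    using f(2) g(2) v by (intro less harmonic_le_arithmetic(2)) (auto simp: add_pos_pos)
  with conv[OF v(1)] have ls: "G (1 / ((f v + g v) / 2), v) < H v" by linarith
  have pos': "0 < (f u + g u) / 2" if "norm u = 1" for u using f(2)[OF that] g(2)[OF that] by simp
  have cf: "continuous_on (sphere 0 1) (\<lambda>u. G (1 / f u, u))"
    and cg: "continuous_on (sphere 0 1) (\<lambda>u. G (1 / g u, u))"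
    using f g by (auto intro: continuous_on_integrand)
  have "polar_vol G (\<lambda>u. (f u + g u) / 2) < (LINT u|spherical_measure. H u)"
    unfolding polar_vol_def
    using f g le ls v pos' cf cg
    by (intro spherical_integral_less[where v=v] continuous_on_integrand) (auto simp: H_def intro!: continuous_intros)
  also have "\<dots> = (polar_vol G f + polar_vol G g) / 2"
    using cf cg unfolding H_def polar_vol_def
    by (simp add: integrable_continuous_on_sphere[OF fin])
  finally show ?thesis .
qed

text \<open>Serves the intermediate value arguments that adjust a volume by dilation, and the choice
  of a dilation factor just below 1.\<close>

lemma continuous_on_polar_vol_scale:
  assumes f: "continuous_on (sphere 0 1) f" "\<And>u. norm u = 1 \<Longrightarrow> 0 < f u" and a: "0 < a"
  shows "continuous_on {a..b} (\<lambda>t. polar_vol G (\<lambda>u. t * f u))"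
  unfolding continuous_on_sequentially comp_def
proof (intro allI ballI impI, elim conjE)
  fix x :: "nat \<Rightarrow> real" and t
  assume t: "t \<in> {a..b}" and x: "\<forall>n. x n \<in> {a..b}" "x \<longlonglongrightarrow> t"
  obtain l r where lr: "0 < l" "l \<le> r" "\<And>u. norm u = 1 \<Longrightarrow> f u \<in> {l..r}"
    using continuous_on_sphere_bounds[OF f] by blast
  have box: "s * f u \<in> {a * l..b * r}" if "s \<in> {a..b}" "norm u = 1" for s u
    using that(1) lr(3)[OF that(2)] a lr(1) by (auto intro!: mult_mono)
  show "(\<lambda>n. polar_vol G (\<lambda>u. x n * f u)) \<longlonglongrightarrow> polar_vol G (\<lambda>u. t * f u)"
  proof (rule polar_vol_limit)
    show "uniform_limit (sphere 0 1) (\<lambda>n u. x n * f u) (\<lambda>u. t * f u) sequentially"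
    proof (rule uniform_limitI)
      fix e :: real assume e: "e > 0"
      have "\<forall>\<^sub>F n in sequentially. dist (x n) t < e / r"
        using x(2) e lr by (intro tendstoD) auto
      then show "\<forall>\<^sub>F n in sequentially. \<forall>u\<in>sphere 0 1. dist (x n * f u) (t * f u) < e"
      proof eventually_elim
        case (elim n)
        show ?case
        proof
          fix u :: 'a assume "u \<in> sphere 0 1"
          then have fu: "0 < f u" "f u \<le> r" using f(2) lr(3) by auto
          have "dist (x n * f u) (t * f u) = dist (x n) t * f u"
            using fu by (simp add: dist_real_def abs_mult left_diff_distrib[symmetric])
          also have "\<dots> \<le> dist (x n) t * r" using fu by (intro mult_left_mono) auto
          also have "\<dots> < e" using elim lr by (simp add: field_simps)
          finally show "dist (x n * f u) (t * f u) < e" .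
        qed
      qed
    qed
    show "0 < a * l" using a lr by simp
  qed (use box x(1) t f in \<open>auto intro!: continuous_intros\<close>)
qed

text \<open>Shrinking a body enlarges its polar. The factor \<open>l\<close> gives at most the
  prescribed volume and a small factor at least that, so some factor in between is exact. That it
  does not exceed \<open>l\<close> is what makes \<open>Q\<close> a good competitor.\<close>

lemma B_tilde_scaled_sum:
  assumes K: "K \<in> bodies_o" and L: "L \<in> bodies_o" and l: "0 < l"
    and le: "polar_vol G (\<lambda>u. l * ((support_fun K u + support_fun L u) / 2)) \<le> polar_vol G (\<lambda>_. 1)"
  obtains Q t where "Q \<in> B_tilde G" "0 < t" "t \<le> l"
    "\<And>u. support_fun Q u = t * ((support_fun K u + support_fun L u) / 2)"
proof -
  define k where "k u = (support_fun K u + support_fun L u) / 2" for u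
  have k: "0 < k u" if "norm u = 1" for u
    using support_fun_pos[OF K that] support_fun_pos[OF L that] by (simp add: k_def)
  have kc: "continuous_on (sphere 0 1) k"
    by (auto simp: k_def intro!: continuous_intros continuous_on_support_fun K L)
  obtain a b where ab: "0 < a" "a \<le> b" "\<And>u. norm u = 1 \<Longrightarrow> k u \<in> {a..b}"
    using continuous_on_sphere_bounds[OF kc k] by blast
  \<comment> \<open>The factor 1 / b makes the scaled mean at most 1, so that its volume is at least
    that of the unit ball; the minimum with \<open>l\<close> orders the endpoints of the
    interval.\<close>
  define s where "s = min l (1 / b)"
  have s: "0 < s" "s \<le> l" "s \<le> 1 / b" using l ab by (auto simp: s_def)
  have "polar_vol G (\<lambda>_. 1) \<le> polar_vol G (\<lambda>u. s * k u)"
  proof (rule polar_vol_antimono)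
    fix u :: 'a assume u: "norm u = 1"
    have "s * k u \<le> 1 / b * b" using ab s ab(3)[OF u] k[OF u] by (intro mult_mono) auto
    then show "s * k u \<le> 1" using ab by simp
  qed (use s k kc in \<open>auto intro!: continuous_intros\<close>)
  moreover have "polar_vol G (\<lambda>u. l * k u) \<le> polar_vol G (\<lambda>_. 1)" using le by (simp add: k_def)
  moreover have "continuous_on {s..l} (\<lambda>t. polar_vol G (\<lambda>u. t * k u))"
    using kc k s(1) by (rule continuous_on_polar_vol_scale)
  ultimately obtain t where t: "s \<le> t" "t \<le> l" "polar_vol G (\<lambda>u. t * k u) = polar_vol G (\<lambda>_. 1)"
    using IVT2'[of "\<lambda>t. polar_vol G (\<lambda>u. t * k u)" l "polar_vol G (\<lambda>_. 1)" s] s by blast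
  obtain Q where Q: "Q \<in> bodies_o" "\<And>u. support_fun Q u = t / 2 * (support_fun K u + support_fun L u)"
    using bodies_o_scaled_sum[OF K L, of "t / 2"] t s by auto
  have hQ: "support_fun Q u = t * k u" for u by (simp add: Q(2) k_def)
  show ?thesis
  proof
    show "Q \<in> B_tilde G" using Q(1) t(3) by (simp add: B_tilde_iff hQ[abs_def])
    show "support_fun Q u = t * ((support_fun K u + support_fun L u) / 2)" for u
      by (simp add: Q(2))
  qed (use t s in auto)
qed

text \<open>
  Both \<open>h_M\<close> and \<open>g\<close> are compared with rescaled means of \<open>M\<close> and \<open>Ms i\<close>. This spares the
  construction of a body with support function \<open>g\<close>, i.e. Blaschke's selection theorem.
\<close>
lemma limit_of_minimizers:
  assumes w: "weakly_converges \<mu>s \<mu>" and \<mu>s: "\<And>i. finite_borel_measure_on_sphere (\<mu>s i)"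
    and \<mu>: "finite_borel_measure_on_sphere \<mu>" "emeasure \<mu> (space \<mu>) \<noteq> 0"
    and conv: "convex_on {0<..} \<phi>" and \<phi>: "\<phi> \<in> class_I"
    and min: "\<And>i. is_minimizer \<phi> (\<mu>s i) (B_tilde G) (Ms i)" and minM: "is_minimizer \<phi> \<mu> (B_tilde G) M"
    and lim: "uniform_limit (sphere 0 1) (\<lambda>i. support_fun (Ms i)) g sequentially"
    and a: "0 < a" and bounds: "\<And>i u. norm u = 1 \<Longrightarrow> support_fun (Ms i) u \<in> {a..b}"
    and v: "norm v = 1"
  shows "g v = support_fun M v"
proof (rule ccontr)
  assume neq: "g v \<noteq> support_fun M v"
  note \<phi>' = class_I_D[OF \<phi>]
  have MsB: "Ms i \<in> B_tilde G" for i using min[of i] by (auto simp: is_minimizer_def)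
  have MB: "M \<in> B_tilde G" using minM by (auto simp: is_minimizer_def)
  have Ms: "Ms i \<in> bodies_o" for i using MsB[of i] by (simp add: B_tilde_iff)
  have M: "M \<in> bodies_o" using MB by (simp add: B_tilde_iff)
  define V where "V = polar_vol G (\<lambda>_. 1)"
  note h_cont = continuous_on_support_fun[OF M] continuous_on_support_fun[OF Ms]
  have g_cont: "continuous_on (sphere 0 1) g"
    by (rule uniform_limit_theorem[OF _ lim]) (auto simp: h_cont)
  have g_bounds: "g u \<in> {a..b}" if u: "norm u = 1" for u
  proof -
    have "(\<lambda>i. support_fun (Ms i) u) \<longlonglongrightarrow> g u" using tendsto_uniform_limitI[OF lim] u by simp
    then show ?thesis using bounds[OF u]
      by (auto intro: LIMSEQ_le_const LIMSEQ_le_const2)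
  qed
  obtain a' b' where ab': "0 < a'" "\<And>u. norm u = 1 \<Longrightarrow> support_fun M u \<in> {a'..b'}"
    using continuous_on_sphere_bounds[OF h_cont(1) support_fun_pos[OF M]] by blast
  \<comment> \<open>One compact interval away from 0 for all functions involved, as the limit
    theorems require.\<close>
  define A B where "A = min a a'" and "B = max b b'"
  have A: "0 < A" using a ab' by (simp add: A_def)
  have gAB: "g u \<in> {A..B}" and hAB: "support_fun (Ms i) u \<in> {A..B}" and MAB: "support_fun M u \<in> {A..B}"
    if "norm u = 1" for u i
    using g_bounds[OF that] bounds[OF that, of i] ab'(2)[OF that] by (auto simp: A_def B_def)
  define ki where "ki i u = (support_fun (Ms i) u + support_fun M u) / 2" for i u
  define k where "k u = (g u + support_fun M u) / 2" for u
  have kiAB: "ki i u \<in> {A..B}" and kAB: "k u \<in> {A..B}" if "norm u = 1" for u i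
    using gAB[OF that] hAB[OF that, of i] MAB[OF that] by (auto simp: ki_def k_def)
  have ki_cont: "continuous_on (sphere 0 1) (ki i)" and k_cont: "continuous_on (sphere 0 1) k" for i
    by (auto simp: ki_def k_def intro!: continuous_intros h_cont g_cont)
  have ulim_scale: "uniform_limit (sphere 0 1) (\<lambda>i u. l * ki i u) (\<lambda>u. l * k u) sequentially"
    if l: "0 < l" "l \<le> 1" for l
  proof (rule uniform_limitI)
    fix e :: real assume "e > 0"
    then have "\<forall>\<^sub>F i in sequentially. \<forall>u\<in>sphere 0 1. dist (support_fun (Ms i) u) (g u) < e"
      by (rule uniform_limitD[OF lim])
    then show "\<forall>\<^sub>F i in sequentially. \<forall>u\<in>sphere 0 1. dist (l * ki i u) (l * k u) < e"
    proof eventually_elim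
      case (elim i)
      show ?case
      proof
        fix u :: 'a assume u: "u \<in> sphere 0 1"
        have "dist (l * ki i u) (l * k u) = l / 2 * dist (support_fun (Ms i) u) (g u)"
          using l by (simp add: ki_def k_def dist_real_def abs_mult flip: right_diff_distrib diff_divide_distrib)
        also have "\<dots> \<le> 1 * dist (support_fun (Ms i) u) (g u)"
          using l by (intro mult_right_mono) auto
        also have "\<dots> < e" using elim u by simp
        finally show "dist (l * ki i u) (l * k u) < e" .
      qed
    qed
  qed
  have "(\<lambda>i. polar_vol G (support_fun (Ms i))) \<longlonglongrightarrow> polar_vol G g"
    by (rule polar_vol_limit[OF lim h_cont(2) a bounds g_bounds])
  moreover have "polar_vol G (support_fun (Ms i)) = V" for i
    using MsB[of i] by (simp add: B_tilde_iff V_def)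
  ultimately have "polar_vol G g = V" by (simp add: tendsto_const_iff)
  moreover have "polar_vol G (support_fun M) = V" using MB by (simp add: B_tilde_iff V_def)
  moreover have "polar_vol G k < (polar_vol G g + polar_vol G (support_fun M)) / 2"
    unfolding k_def using neq v A gAB MAB
    by (intro polar_vol_average_less[where v=v] g_cont h_cont) (auto intro: order.strict_trans2)
  ultimately have kV: "polar_vol G k < V" by simp
  have kpos: "0 < k u" if "norm u = 1" for u using kAB[OF that] A by auto
  \<comment> \<open>The strict gap below \<open>V\<close> leaves room to shrink: by continuity at
    the factor 1 some factor below 1 still gives volume below \<open>V\<close>.\<close>
  have "continuous_on {1 / 2..1} (\<lambda>t. polar_vol G (\<lambda>u. t * k u))"
    by (rule continuous_on_polar_vol_scale[OF k_cont kpos]) auto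
  then have "((\<lambda>t. polar_vol G (\<lambda>u. t * k u)) \<longlongrightarrow> polar_vol G (\<lambda>u. 1 * k u)) (at 1 within {1 / 2..1})"
    unfolding continuous_on_def by (rule bspec[where x=1]) simp
  then have "((\<lambda>t. polar_vol G (\<lambda>u. t * k u)) \<longlongrightarrow> polar_vol G (\<lambda>u. 1 * k u)) (at_left 1)"
    by (simp add: at_within_Icc_at_left)
  then have "\<forall>\<^sub>F t in at_left 1. polar_vol G (\<lambda>u. t * k u) < V"
    using kV by (intro order_tendstoD) auto
  moreover have "\<forall>\<^sub>F t in at_left (1::real). 0 < t \<and> t < 1"
    using eventually_at_left_real[of 0 "1::real"] by (auto elim: eventually_mono)
  ultimately obtain l where l: "0 < l" "l < 1" "polar_vol G (\<lambda>u. l * k u) < V"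
    using eventually_happens[OF eventually_conj] trivial_limit_at_left_real by (metis (no_types, lifting))
  have bd: "l * ki i u \<in> {l * A..B}" "l * k u \<in> {l * A..B}" if u: "norm u = 1" for i u
  proof -
    have "l * x \<in> {l * A..B}" if "x \<in> {A..B}" for x
    proof -
      have "l * A \<le> l * x" using that l by auto
      moreover have "l * x \<le> 1 * x" using that l A by (intro mult_right_mono) auto
      ultimately show ?thesis using that by auto
    qed
    then show "l * ki i u \<in> {l * A..B}" "l * k u \<in> {l * A..B}" using kiAB[OF u] kAB[OF u] by auto
  qed
  have lA: "0 < l * A" using l A by simp
  note ulim = ulim_scale[OF l(1) less_imp_le[OF l(2)]]
  have lki_cont: "continuous_on (sphere 0 1) (\<lambda>u. l * ki i u)" for i by (intro continuous_intros ki_cont)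
  have lk_cont: "continuous_on (sphere 0 1) (\<lambda>u. l * k u)" by (intro continuous_intros k_cont)
  have \<phi>cont: "continuous_on (sphere 0 1) (\<lambda>u. \<phi> (f u))"
    if "continuous_on (sphere 0 1) f" "\<And>u. norm u = 1 \<Longrightarrow> 0 < f u" for f
    using that by (intro continuous_on_compose2[OF \<phi>'(1) that(1)]) auto
  have \<phi>mono: "\<phi> s \<le> \<phi> t" if "0 < s" "s \<le> t" for s t
    using strict_mono_onD[OF \<phi>'(2), of s t] that by (cases "s = t") auto
  have "(\<lambda>i. polar_vol G (\<lambda>u. l * ki i u)) \<longlonglongrightarrow> polar_vol G (\<lambda>u. l * k u)"
    by (rule polar_vol_limit[OF ulim lki_cont lA bd])
  then have "\<forall>\<^sub>F i in sequentially. polar_vol G (\<lambda>u. l * ki i u) < V"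
    using l(3) by (rule order_tendstoD)
  \<comment> \<open>For large i the scaled mean with \<open>Ms i\<close> has volume below
    \<open>V\<close>, so it can be shrunk to a \<open>Q\<close> admissible in both problems. As
    \<open>t \<le> l\<close> and \<open>\<phi>\<close> increases, \<open>Q\<close> does at least as
    well as the function \<open>l * ki i\<close>.\<close>
  then have ev: "\<forall>\<^sub>F i in sequentially.
      (LINT u|\<mu>s i. \<phi> (support_fun (Ms i) u)) \<le> (LINT u|\<mu>s i. \<phi> (l * ki i u)) \<and>
      (LINT u|\<mu>. \<phi> (support_fun M u)) \<le> (LINT u|\<mu>. \<phi> (l * ki i u))"
  proof eventually_elim
    case (elim i)
    have "polar_vol G (\<lambda>u. l * ((support_fun (Ms i) u + support_fun M u) / 2)) \<le> polar_vol G (\<lambda>_. 1)"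
      using elim unfolding ki_def V_def by (rule less_imp_le)
    from B_tilde_scaled_sum[OF Ms M l(1) this]
    obtain Q t where Q: "Q \<in> B_tilde G" "0 < t" "t \<le> l" "\<And>u. support_fun Q u = t * ki i u"
      unfolding ki_def by blast
    have kip: "0 < ki i u" if "norm u = 1" for u using kiAB[OF that, of i] A by auto
    have Qle: "(LINT u|\<nu>. \<phi> (support_fun Q u)) \<le> (LINT u|\<nu>. \<phi> (l * ki i u))"
      if "finite_borel_measure_on_sphere \<nu>" for \<nu>
      unfolding Q(4) using kip l Q
      by (intro integral_mono_on_sphere[OF that] \<phi>cont \<phi>mono)
        (auto intro!: continuous_intros ki_cont mult_right_mono less_imp_le[OF kip])
    have sub: "B_tilde G \<subseteq> bodies_o" by (auto simp: B_tilde_def)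
    show ?case
      using is_minimizer_le[OF min[of i] Q(1) sub \<mu>s \<phi>'(3)] is_minimizer_le[OF minM Q(1) sub \<mu>(1) \<phi>'(3)]
        Qle[OF \<mu>s[of i]] Qle[OF \<mu>(1)] by linarith
  qed
  have lim1: "(\<lambda>i. LINT u|\<mu>s i. \<phi> (support_fun (Ms i) u)) \<longlonglongrightarrow> (LINT u|\<mu>. \<phi> (g u))"
    by (rule weakly_converges_compose[OF w \<mu>s \<mu>(1) \<phi>'(1) lim h_cont(2) a bounds g_bounds])
  have lim2: "(\<lambda>i. LINT u|\<mu>s i. \<phi> (l * ki i u)) \<longlonglongrightarrow> (LINT u|\<mu>. \<phi> (l * k u))"
    by (rule weakly_converges_compose[OF w \<mu>s \<mu>(1) \<phi>'(1) ulim lki_cont lA bd])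
  have lim3: "(\<lambda>i. LINT u|\<mu>. \<phi> (l * ki i u)) \<longlonglongrightarrow> (LINT u|\<mu>. \<phi> (l * k u))"
    by (rule weakly_converges_compose[OF weakly_converges_const \<mu>(1) \<mu>(1) \<phi>'(1) ulim lki_cont lA bd])
  have gl: "(LINT u|\<mu>. \<phi> (g u)) \<le> (LINT u|\<mu>. \<phi> (l * k u))"
    using ev by (intro tendsto_le[OF _ lim2 lim1]) (auto elim: eventually_mono)
  have ml: "(LINT u|\<mu>. \<phi> (support_fun M u)) \<le> (LINT u|\<mu>. \<phi> (l * k u))"
    using ev by (intro tendsto_le[OF _ lim3 tendsto_const]) (auto elim: eventually_mono)
  have gpos: "0 < g u" if "norm u = 1" for u using gAB[OF that] A by auto
  note mpos = support_fun_pos[OF M]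
  \<comment> \<open>By \<open>gl\<close> and \<open>ml\<close> the left side is at least each of the
    two integrals averaged on the right. Midpoint convexity of \<open>\<phi>\<close> and the factor
    \<open>l < 1\<close> give strictness at every \<open>u\<close>, so it only remains that
    \<open>\<mu>\<close> has positive mass.\<close>
  have "(LINT u|\<mu>. \<phi> (l * k u)) < (LINT u|\<mu>. (\<phi> (g u) + \<phi> (support_fun M u)) / 2)"
  proof (rule integral_less_on_sphere[OF \<mu>(1), where A="sphere 0 1"])
    have strict: "\<phi> (l * k u) < (\<phi> (g u) + \<phi> (support_fun M u)) / 2" if u: "norm u = 1" for u
    proof -
      have "\<phi> (l * k u) < \<phi> (k u)"
        using kpos[OF u] l by (intro strict_mono_onD[OF \<phi>'(2)]) auto
      also have "\<phi> (k u) \<le> (\<phi> (g u) + \<phi> (support_fun M u)) / 2"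
        using convex_onD[OF conv, of "1 / 2" "g u" "support_fun M u"] gpos[OF u] mpos[OF u]
        by (simp add: k_def add_divide_distrib)
      finally show ?thesis .
    qed
    show "\<phi> (l * k u) \<le> (\<phi> (g u) + \<phi> (support_fun M u)) / 2" if "norm u = 1" for u
      using strict[OF that] by simp
    show "\<phi> (l * k u) < (\<phi> (g u) + \<phi> (support_fun M u)) / 2" if "u \<in> sphere 0 1" for u
      using strict that by simp
    show "emeasure \<mu> (sphere 0 1) \<noteq> 0" using \<mu> by (simp add: space_finite_borel_measure_on_sphere)
    show "continuous_on (sphere 0 1) (\<lambda>u. \<phi> (l * k u))" using l kpos by (intro \<phi>cont lk_cont) auto
    show "continuous_on (sphere 0 1) (\<lambda>u. (\<phi> (g u) + \<phi> (support_fun M u)) / 2)"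
      by (intro continuous_intros \<phi>cont g_cont h_cont gpos mpos) auto
  qed (auto intro: borel_closed)
  also have "\<dots> = ((LINT u|\<mu>. \<phi> (g u)) + (LINT u|\<mu>. \<phi> (support_fun M u))) / 2"
    using \<phi>cont[OF g_cont gpos] \<phi>cont[OF h_cont(1) mpos]
    by (simp add: integrable_continuous_on_sphere[OF \<mu>(1)])
  finally show False using gl ml by simp
qed

end

section \<open>Compactness and convergence in the Hausdorff metric\<close>

lemma hausdorff_dist_le:
  fixes K L :: "'a::euclidean_space set"
  assumes "\<And>u. norm u = 1 \<Longrightarrow> \<bar>support_fun K u - support_fun L u\<bar> \<le> e"
  shows "hausdorff_dist K L \<le> e"
proof -
  obtain b :: 'a where "b \<in> Basis" using nonempty_Basis by blast
  then have "b \<in> sphere 0 1" by (simp add: norm_Basis)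
  then show ?thesis unfolding hausdorff_dist_def using assms by (intro cSUP_least) auto
qed

lemma hausdorff_dist_nonneg:
  fixes K L :: "'a::euclidean_space set"
  assumes "K \<in> bodies_o" "L \<in> bodies_o"
  shows "0 \<le> hausdorff_dist K L"
proof -
  obtain b :: 'a where "b \<in> Basis" using nonempty_Basis by blast
  then have b: "b \<in> sphere 0 1" by (simp add: norm_Basis)
  have "compact ((\<lambda>u. \<bar>support_fun K u - support_fun L u\<bar>) ` sphere 0 1)"
    using assms by (intro compact_continuous_image continuous_intros continuous_on_support_fun) auto
  then have "bdd_above ((\<lambda>u. \<bar>support_fun K u - support_fun L u\<bar>) ` sphere 0 1)"
    by (intro bounded_imp_bdd_above compact_imp_bounded)
  from cSUP_upper[OF b this] show ?thesis unfolding hausdorff_dist_def by linarith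
qed

text \<open>Bodies in the ball of radius \<open>R\<close> have support functions with common
  Lipschitz constant \<open>R\<close>, which supplies the equicontinuity; the lower bound
  \<open>\<delta>\<close> keeps the limit function positive, so that \<open>G\<close> and
  \<open>\<phi>\<close> are evaluated where they are continuous.\<close>

lemma (in dual_volume_integrand) minimizers_converge:
  assumes dim: "2 \<le> DIM('a)"
    and w: "weakly_converges \<mu>s \<mu>" and \<mu>s: "\<And>i. finite_borel_measure_on_sphere (\<mu>s i)"
    and \<mu>: "finite_borel_measure_on_sphere \<mu>" "emeasure \<mu> (space \<mu>) \<noteq> 0" "not_conc_on_closed_hemisphere \<mu>"
    and conv: "convex_on {0<..} \<phi>" and \<phi>: "\<phi> \<in> class_I"
    and min: "\<And>i. is_minimizer \<phi> (\<mu>s i) (B_tilde G) (Ms i)" and minM: "is_minimizer \<phi> \<mu> (B_tilde G) M"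
  shows "(\<lambda>i. hausdorff_dist (Ms i) M) \<longlonglongrightarrow> 0"
proof (rule ccontr)
  assume "\<not> ?thesis"
  then obtain \<epsilon> where \<epsilon>: "\<epsilon> > 0" "\<not> (\<forall>\<^sub>F i in sequentially. dist (hausdorff_dist (Ms i) M) 0 < \<epsilon>)"
    unfolding tendsto_iff by blast
  then obtain r :: "nat \<Rightarrow> nat" where r: "strict_mono r" "\<And>i. \<not> dist (hausdorff_dist (Ms (r i)) M) 0 < \<epsilon>"
    using not_eventually_sequentiallyD by blast
  obtain R where R: "0 < R" "\<forall>\<^sub>F i in sequentially. \<forall>x\<in>Ms i. norm x \<le> R"
    using minimizers_bounded[OF w \<mu>s \<mu>(1,3) conv \<phi> min] by blast
  then obtain N where N: "\<And>i x. N \<le> i \<Longrightarrow> x \<in> Ms i \<Longrightarrow> norm x \<le> R"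
    unfolding eventually_sequentially by blast
  \<comment> \<open>The bound \<open>R\<close> holds only eventually; the shift by \<open>N\<close>
    makes it hold at every index of the subsequence, since \<open>r j \<ge> j\<close>.\<close>
  define s where "s i = r (i + N)" for i
  have s: "strict_mono s" using r(1) by (auto simp: s_def strict_mono_def)
  have sR: "norm x \<le> R" if "x \<in> Ms (s i)" for i x
    using N[of "s i" x] that seq_suble[OF r(1), of "i + N"] by (simp add: s_def)
  have MsB: "Ms i \<in> B_tilde G" for i using min[of i] by (auto simp: is_minimizer_def)
  have Ms: "Ms i \<in> bodies_o" for i using MsB[of i] by (simp add: B_tilde_iff)
  have M: "M \<in> bodies_o" using minM by (simp add: is_minimizer_def B_tilde_iff)
  obtain \<delta> where \<delta>: "0 < \<delta>" "\<And>Q u. Q \<in> bodies_o \<Longrightarrow> (\<And>x. x \<in> Q \<Longrightarrow> norm x \<le> R) \<Longrightarrow>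
    polar_vol G (support_fun Q) \<le> polar_vol G (\<lambda>_. 1) \<Longrightarrow> norm u = 1 \<Longrightarrow> \<delta> \<le> support_fun Q u"
    using support_fun_lower_bound[OF dim R(1)] by blast
  have bounds: "support_fun (Ms (s i)) u \<in> {\<delta>..R}" if "norm u = 1" for i u
  proof -
    have "\<delta> \<le> support_fun (Ms (s i)) u"
      using MsB[of "s i"] sR that by (intro \<delta>(2)) (auto simp: B_tilde_iff)
    moreover have "support_fun (Ms (s i)) u \<le> R"
      using bodies_oD(4)[OF Ms] sR that by (intro support_fun_le) auto
    ultimately show ?thesis by simp
  qed
  obtain g k where k: "strict_mono (k :: nat \<Rightarrow> nat)" and
    g: "\<And>e. 0 < e \<Longrightarrow> \<exists>N. \<forall>n x. n \<ge> N \<and> x \<in> sphere 0 1 \<longrightarrow> norm (support_fun (Ms (s (k n))) x - g x) < e"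
  proof (rule Arzela_Ascoli[of "sphere (0::'a) 1" "\<lambda>i. support_fun (Ms (s i))" R])
    show "compact (sphere (0::'a) 1)" by simp
    show "norm (support_fun (Ms (s n)) x) \<le> R" if "x \<in> sphere 0 1" for n x
      using bounds[of x n] that \<delta>(1) by auto
    show "\<exists>d. 0 < d \<and> (\<forall>n y. y \<in> sphere 0 1 \<and> norm (x - y) < d \<longrightarrow>
        norm (support_fun (Ms (s n)) x - support_fun (Ms (s n)) y) < e)" if "0 < e" for x e
    proof (intro exI[of _ "e / R"] conjI allI impI)
      show "0 < e / R" using that R by simp
      fix n y assume y: "y \<in> sphere 0 1 \<and> norm (x - y) < e / R"
      have "norm (support_fun (Ms (s n)) x - support_fun (Ms (s n)) y) \<le> R * norm (x - y)"
        using support_fun_lipschitz[OF bodies_oD(4)[OF Ms] sR] by simp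
      also have "\<dots> < e" using y R by (simp add: field_simps)
      finally show "norm (support_fun (Ms (s n)) x - support_fun (Ms (s n)) y) < e" .
    qed
  qed (use that in blast)
  define p where "p i = s (k i)" for i
  have p: "strict_mono p" using s k by (auto simp: p_def strict_mono_def)
  have lim: "uniform_limit (sphere 0 1) (\<lambda>i. support_fun (Ms (p i))) g sequentially"
    unfolding uniform_limit_sequentially_iff dist_norm p_def using g by blast
  have gM: "g u = support_fun M u" if "norm u = 1" for u
    by (rule limit_of_minimizers[where b=R, OF weakly_converges_subseq[OF w p] \<mu>s \<mu>(1,2) conv \<phi> min minM lim \<delta>(1) _ that])
      (use bounds in \<open>simp add: p_def\<close>)
  obtain i where i: "\<And>u. norm u = 1 \<Longrightarrow> dist (support_fun (Ms (p i)) u) (g u) < \<epsilon> / 2"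
    using uniform_limitD[OF lim, of "\<epsilon> / 2"] \<epsilon>(1) by (force simp: eventually_sequentially)
  then have "hausdorff_dist (Ms (p i)) M \<le> \<epsilon> / 2"
    by (intro hausdorff_dist_le) (fastforce simp: gM dist_real_def)
  with hausdorff_dist_nonneg[OF Ms M, of "p i"] r(2)[of "k i + N"] \<epsilon>(1) show False
    by (simp add: p_def s_def)
qed

section \<open>Homogeneous dual volumes\<close>

lemma measure_spherical_measure_sphere_pos:
  "0 < measure (spherical_measure :: 'a::euclidean_space measure) (sphere 0 1)"
proof -
  obtain b :: 'a where "b \<in> Basis" using nonempty_Basis by blast
  then have "norm b = 1" by (simp add: norm_Basis)
  from spherical_integral_less[of "\<lambda>_. 0" "\<lambda>_. 1" b, OF _ _ _ this]
  have "(LINT u|(spherical_measure :: 'a measure). 0::real) < (LINT u|(spherical_measure :: 'a measure). 1)" by simp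
  then show ?thesis
    unfolding integral_const_on_sphere[OF finite_borel_measure_on_sphere_spherical_measure] by simp
qed

context dual_volume_integrand
begin

lemma polar_vol_scale_strict_antimono:
  assumes f: "continuous_on (sphere 0 1) f" "\<And>u. norm u = 1 \<Longrightarrow> 0 < f u" and st: "0 < s" "s < t"
  shows "polar_vol G (\<lambda>u. t * f u) < polar_vol G (\<lambda>u. s * f u)"
proof -
  obtain b :: 'a where "b \<in> Basis" using nonempty_Basis by blast
  then have b: "norm b = 1" by (simp add: norm_Basis)
  have *: "G (1 / (t * f u), u) < G (1 / (s * f u), u)" if u: "norm u = 1" for u
    using f(2)[OF u] st u by (intro less divide_strict_left_mono mult_strict_right_mono) auto
  show ?thesis unfolding polar_vol_def
    using f st * b less_imp_le[OF *]
    by (intro spherical_integral_less[where v=b] continuous_on_integrand) (auto intro!: continuous_intros)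
qed

text \<open>Dominated convergence: the factors \<open>Suc n\<close> are at least 1, so by
  monotonicity the undilated integrand is a majorant.\<close>

lemma polar_vol_scale_tendsto_0:
  assumes f: "continuous_on (sphere 0 1) f" "\<And>u. norm u = 1 \<Longrightarrow> 0 < f u"
    and lim0: "\<And>u. norm u = 1 \<Longrightarrow> ((\<lambda>t. G (t, u)) \<longlongrightarrow> 0) (at_right 0)"
  shows "(\<lambda>n. polar_vol G (\<lambda>u. real (Suc n) * f u)) \<longlonglongrightarrow> 0"
proof -
  note fin = finite_borel_measure_on_sphere_spherical_measure
  have cont: "continuous_on (sphere 0 1) (\<lambda>u. G (1 / (real (Suc n) * f u), u))" for n
    using f by (intro continuous_on_integrand continuous_intros) auto
  have "(\<lambda>n. LINT u|spherical_measure. G (1 / (real (Suc n) * f u), u)) \<longlonglongrightarrow> (LINT u|(spherical_measure :: 'a measure). 0)"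
  proof (rule integral_dominated_convergence)
    show "(\<lambda>u. G (1 / (real (Suc n) * f u), u)) \<in> borel_measurable spherical_measure" for n
      using integrable_continuous_on_sphere[OF fin cont] by (rule borel_measurable_integrable)
    show "integrable spherical_measure (\<lambda>u. G (1 / f u, u))"
      using f by (intro integrable_continuous_on_sphere[OF fin] continuous_on_integrand)
    show "AE u in spherical_measure. (\<lambda>n. G (1 / (real (Suc n) * f u), u)) \<longlonglongrightarrow> 0"
    proof (rule AE_I2)
      fix u :: 'a assume "u \<in> space spherical_measure"
      then have u: "norm u = 1" by simp
      have "filterlim (\<lambda>n. 1 / (real (Suc n) * f u)) (at_right 0) sequentially"
      proof (rule tendsto_imp_filterlim_at_right)
        have "(\<lambda>n. 1 / real (Suc n) * (1 / f u)) \<longlonglongrightarrow> 0 * (1 / f u)"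
          using LIMSEQ_Suc[OF lim_const_over_n[of "1::real"]] by (intro tendsto_intros) simp
        then show "(\<lambda>n. 1 / (real (Suc n) * f u)) \<longlonglongrightarrow> 0" by simp
        show "\<forall>\<^sub>F n in sequentially. 0 < 1 / (real (Suc n) * f u)"
          using f(2)[OF u] by (intro always_eventually) simp
      qed
      with lim0[OF u] show "(\<lambda>n. G (1 / (real (Suc n) * f u), u)) \<longlonglongrightarrow> 0"
        by (rule filterlim_compose)
    qed
    fix n
    show "AE u in spherical_measure. norm (G (1 / (real (Suc n) * f u), u)) \<le> G (1 / f u, u)"
    proof (rule AE_I2)
      fix u :: 'a assume "u \<in> space spherical_measure"
      then have u: "norm u = 1" by simp
      have "1 * f u \<le> real (Suc n) * f u" using f(2)[OF u] by (intro mult_right_mono) auto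
      then have "1 / (real (Suc n) * f u) \<le> 1 / f u" using f(2)[OF u] by (intro frac_le) auto
      moreover have p: "0 < 1 / (real (Suc n) * f u)" using f(2)[OF u] by simp
      ultimately show "norm (G (1 / (real (Suc n) * f u), u)) \<le> G (1 / f u, u)"
        using mono[OF p _ u] pos[OF p u] by simp
    qed
  qed simp
  then show ?thesis by (simp add: polar_vol_def)
qed

lemma polar_vol_scale_large:
  assumes dim: "2 \<le> DIM('a)" and f: "continuous_on (sphere 0 1) f" "\<And>u. norm u = 1 \<Longrightarrow> 0 < f u"
  obtains s where "0 < s" "s \<le> 1" "1 \<le> polar_vol G (\<lambda>u. s * f u)"
proof -
  define p where "p = DIM('a) - 1"
  have p: "p \<ge> 1" using dim by (simp add: p_def)
  obtain c T where c: "c > 0" "T > 0" and cT: "\<And>t u. t \<ge> T \<Longrightarrow> norm u = 1 \<Longrightarrow> c * t ^ p \<le> G (t, u)"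
    using growth unfolding p_def by blast
  obtain a b where ab: "0 < a" "a \<le> b" "\<And>u. norm u = 1 \<Longrightarrow> f u \<in> {a..b}"
    using continuous_on_sphere_bounds[OF f] by blast
  define m where "m = measure (spherical_measure :: 'a measure) (sphere 0 1)"
  have m: "m > 0" unfolding m_def by (rule measure_spherical_measure_sphere_pos)
  \<comment> \<open>Four demands are met at once: the growth bound holds at \<open>t\<close>,
    \<open>t ^ p\<close> is at least \<open>t\<close>, the final estimate c t m is at least 1, and
    \<open>s\<close> is at most 1. With \<open>s = 1 / (t * b)\<close> the argument 1 / (s f) is at
    least \<open>t\<close> everywhere, because \<open>f\<close> is at most \<open>b\<close>.\<close>
  define t where "t = max (max T 1) (max (1 / (c * m)) (1 / b))"
  have t: "T \<le> t" "1 \<le> t" "1 / (c * m) \<le> t" "1 / b \<le> t" by (auto simp: t_def)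
  define s where "s = 1 / (t * b)"
  have s: "0 < s" using ab t by (simp add: s_def)
  have "1 / b * b \<le> t * b" using t ab by (intro mult_right_mono) auto
  then have s1: "s \<le> 1" using ab t by (simp add: s_def)
  have pw: "c * t \<le> G (1 / (s * f u), u)" if u: "norm u = 1" for u
  proof -
    have "c * t \<le> c * t ^ p" using c t p power_increasing[of 1 p t] by (intro mult_left_mono) auto
    also have "\<dots> \<le> G (t, u)" using t(1) u by (rule cT)
    also have "\<dots> \<le> G (1 / (s * f u), u)"
    proof (rule mono[OF _ _ u])
      have "s * f u \<le> s * b" using ab(3)[OF u] s by (intro mult_left_mono) auto
      also have "\<dots> = 1 / t" using ab by (simp add: s_def)
      finally show "t \<le> 1 / (s * f u)" using s t f(2)[OF u] by (simp add: field_simps)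
    qed (use t in simp)
    finally show ?thesis .
  qed
  have "1 \<le> c * t * m" using t(3) c m by (simp add: field_simps)
  also have "\<dots> = (LINT u|(spherical_measure :: 'a measure). c * t)"
    unfolding integral_const_on_sphere[OF finite_borel_measure_on_sphere_spherical_measure] m_def ..
  also have "\<dots> \<le> polar_vol G (\<lambda>u. s * f u)"
    unfolding polar_vol_def using f s pw
    by (intro integral_mono_on_sphere[OF finite_borel_measure_on_sphere_spherical_measure]
      continuous_on_integrand continuous_intros) auto
  finally show ?thesis using that s s1 by blast
qed

text \<open>The volume is continuous and strictly decreasing in the dilation factor, at least 1 for
  a small factor and below 1 for a large one. It equals 1 for exactly one factor, the set under the
  infimum is the closed ray starting there, and the infimum is that factor.\<close>

lemma homogeneous_scale:
  assumes dim: "2 \<le> DIM('a)" and f: "continuous_on (sphere 0 1) f" "\<And>u. norm u = 1 \<Longrightarrow> 0 < f u"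
    and lim0: "\<And>u. norm u = 1 \<Longrightarrow> ((\<lambda>t. G (t, u)) \<longlongrightarrow> 0) (at_right 0)"
    and \<eta>: "\<eta> = Inf {\<eta>. 0 < \<eta> \<and> polar_vol G (\<lambda>u. \<eta> * f u) \<le> 1}"
  shows "0 < \<eta>" "\<And>t. 0 < t \<Longrightarrow> polar_vol G (\<lambda>u. t * f u) = 1 \<longleftrightarrow> t = \<eta>"
proof -
  let ?F = "\<lambda>t. polar_vol G (\<lambda>u. t * f u)"
  obtain s where s: "0 < s" "s \<le> 1" "1 \<le> ?F s" using polar_vol_scale_large[OF dim f] by blast
  have "\<forall>\<^sub>F n in sequentially. ?F (real (Suc n)) < 1"
    by (rule order_tendstoD(2)[OF polar_vol_scale_tendsto_0[OF f lim0]]) auto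
  then obtain n where n: "?F (real (Suc n)) < 1" by (auto simp: eventually_sequentially)
  have "s \<le> real (Suc n)" using s by simp
  moreover have "continuous_on {s..real (Suc n)} ?F" using f s(1) by (rule continuous_on_polar_vol_scale)
  ultimately obtain t where t: "s \<le> t" "?F t = 1"
    using IVT2'[of ?F "real (Suc n)" 1 s] s n by fastforce
  have strict: "?F b < ?F a" if "0 < a" "a < b" for a b
    using f that by (rule polar_vol_scale_strict_antimono)
  have t0: "0 < t" using s t by simp
  have "{\<eta>. 0 < \<eta> \<and> ?F \<eta> \<le> 1} = {t..}"
  proof (intro equalityI subsetI)
    fix x assume "x \<in> {\<eta>. 0 < \<eta> \<and> ?F \<eta> \<le> 1}"
    then show "x \<in> {t..}" using strict[of x t] t by force
  next
    fix x assume "x \<in> {t..}"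
    then show "x \<in> {\<eta>. 0 < \<eta> \<and> ?F \<eta> \<le> 1}" using strict[of t x] t t0 by (cases "x = t") auto
  qed
  then have eq: "\<eta> = t" using \<eta> by simp
  then show "0 < \<eta>" using t0 by simp
  show "?F x = 1 \<longleftrightarrow> x = \<eta>" if "0 < x" for x
    using strict[of x t] strict[of t x] that t0 t(2) eq by (cases x t rule: linorder_cases) auto
qed

lemma hom_dual_vol_eq:
  assumes "\<And>u. norm u = 1 \<Longrightarrow> radial_fun K u = 1 / f u"
  shows "hom_dual_vol G K = Inf {\<eta>. 0 < \<eta> \<and> polar_vol G (\<lambda>u. \<eta> * f u) \<le> 1}"
proof -
  have "(LINT u|spherical_measure. G (radial_fun K u / \<eta>, u)) = polar_vol G (\<lambda>u. \<eta> * f u)" for \<eta>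
    unfolding polar_vol_def
    by (rule integral_cong_on_sphere[OF finite_borel_measure_on_sphere_spherical_measure])
      (simp add: assms mult.commute)
  then show ?thesis by (simp add: hom_dual_vol_def)
qed

text \<open>With \<eta> the homogeneous volume of the ball, having homogeneous volume \<eta> means
  that the integral with arguments divided by \<eta> equals 1. The ball satisfies this too, so 1 is
  precisely the value that \<open>B_tilde\<close> prescribes for the rescaled integrand.\<close>

lemma B_hat_eq_B_tilde:
  assumes dim: "2 \<le> DIM('a)"
    and lim0: "\<And>u. norm u = 1 \<Longrightarrow> ((\<lambda>t. G (t, u)) \<longlongrightarrow> 0) (at_right 0)"
  obtains \<eta> where "0 < \<eta>" "B_hat G = B_tilde (\<lambda>p. G (fst p / \<eta>, snd p))"
proof
  define \<eta> where "\<eta> = hom_dual_vol G (cball 0 1)"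
  have "\<eta> = Inf {\<eta>. 0 < \<eta> \<and> polar_vol G (\<lambda>u. \<eta> * 1) \<le> 1}"
    unfolding \<eta>_def by (rule hom_dual_vol_eq) (simp add: radial_fun_unit_ball)
  from homogeneous_scale[OF dim _ _ lim0 this]
  have \<eta>: "0 < \<eta>" and \<eta>1: "\<And>t. 0 < t \<Longrightarrow> polar_vol G (\<lambda>u. t * 1) = 1 \<longleftrightarrow> t = \<eta>" by auto
  show "0 < \<eta>" by (rule \<eta>)
  have pv: "polar_vol (\<lambda>p. G (fst p / \<eta>, snd p)) f = polar_vol G (\<lambda>u. \<eta> * f u)" for f
    by (simp add: polar_vol_def mult.commute)
  have "hom_dual_vol G (polar_body Q) = \<eta> \<longleftrightarrow> polar_vol G (\<lambda>u. \<eta> * support_fun Q u) = 1"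
    if Q: "Q \<in> bodies_o" for Q
    using homogeneous_scale(2)[OF dim continuous_on_support_fun[OF Q] support_fun_pos[OF Q] lim0
        hom_dual_vol_eq[OF radial_fun_polar_body[OF Q]] \<eta>] by auto
  moreover have "Q \<in> B_hat G \<longleftrightarrow> Q \<in> bodies_o \<and> hom_dual_vol G (polar_body Q) = \<eta>" for Q
    by (simp add: B_hat_def \<eta>_def)
  moreover have "Q \<in> B_tilde (\<lambda>p. G (fst p / \<eta>, snd p)) \<longleftrightarrow>
      Q \<in> bodies_o \<and> polar_vol G (\<lambda>u. \<eta> * support_fun Q u) = 1" for Q
    using \<eta>1[OF \<eta>] by (simp add: B_tilde_iff pv)
  ultimately show "B_hat G = B_tilde (\<lambda>p. G (fst p / \<eta>, snd p))" by blast
qed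

lemma scaled_integrand:
  assumes \<eta>: "0 < \<eta>"
  shows "dual_volume_integrand (\<lambda>p. G (fst p / \<eta>, snd p))"
proof
  show "continuous_on ({0<..} \<times> sphere 0 1) (\<lambda>p. G (fst p / \<eta>, snd p))"
    using \<eta> by (intro continuous_on_compose2[OF continuous] continuous_intros) auto
  show "0 < G (fst (t, u) / \<eta>, snd (t, u))" if "0 < t" "norm u = 1" for t u
    using that \<eta> by (simp add: pos)
  show "G (fst (s, u) / \<eta>, snd (s, u)) < G (fst (t, u) / \<eta>, snd (t, u))"
    if "0 < s" "s < t" "norm u = 1" for s t u
    using that \<eta> by (simp add: less divide_strict_right_mono)
  show "convex_on {0<..} (\<lambda>t. G (fst (t, u) / \<eta>, snd (t, u)))" if u: "norm u = 1" for u
  proof (rule convex_onI)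
    fix t x y :: real assume t: "0 < t" "t < 1" and "x \<in> {0<..}" "y \<in> {0<..}"
    then have "G ((1 - t) *\<^sub>R (x / \<eta>) + t *\<^sub>R (y / \<eta>), u) \<le> (1 - t) * G (x / \<eta>, u) + t * G (y / \<eta>, u)"
      using \<eta> by (intro convex_onD[OF convex[OF u]]) auto
    then show "G (fst ((1 - t) *\<^sub>R x + t *\<^sub>R y, u) / \<eta>, snd ((1 - t) *\<^sub>R x + t *\<^sub>R y, u))
        \<le> (1 - t) * G (fst (x, u) / \<eta>, snd (x, u)) + t * G (fst (y, u) / \<eta>, snd (y, u))"
      by (simp add: add_divide_distrib)
  qed simp
  obtain c T where c: "c > 0" "T > 0"
    and cT: "\<And>t u. t \<ge> T \<Longrightarrow> norm u = 1 \<Longrightarrow> c * t ^ (DIM('a) - 1) \<le> G (t, u)"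
    using growth by blast
  have "c / \<eta> ^ (DIM('a) - 1) * t ^ (DIM('a) - 1) \<le> G (fst (t, u) / \<eta>, snd (t, u))"
    if "\<eta> * T \<le> t" "norm u = 1" for t u
    using cT[of "t / \<eta>" u] that \<eta> by (simp add: field_simps power_divide)
  moreover have "0 < c / \<eta> ^ (DIM('a) - 1)" "0 < \<eta> * T" using c \<eta> by auto
  ultimately show "\<exists>c>0. \<exists>T>0. \<forall>t\<ge>T. \<forall>u. norm u = 1 \<longrightarrow>
      c * t ^ (DIM('a) - 1) \<le> G (fst (t, u) / \<eta>, snd (t, u))" by blast
qed

end

text \<open>The quotients are positive, so the real infimum is a true lower bound and can serve as
  \<open>c\<close> with threshold 1; for t at least 1 the power with exponent q dominates the one
  with exponent n - 1.\<close>

lemma class_GI_integrand: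
  fixes G :: "real \<times> 'a::euclidean_space \<Rightarrow> real"
  assumes G: "G \<in> class_GI" and conv: "\<And>u. u \<in> sphere 0 1 \<Longrightarrow> convex_on {0<..} (\<lambda>t. G (t, u))"
    and q: "real DIM('a) - 1 \<le> q"
    and growth: "(INF (t, u)\<in>{1..} \<times> sphere 0 1. G (t, u) / t powr q) > 0"
  shows "dual_volume_integrand G"
proof
  show "continuous_on ({0<..} \<times> sphere 0 1) G" using G by (simp add: class_GI_def)
  show pos: "0 < G (t, u)" if "0 < t" "norm u = 1" for t u using G that by (simp add: class_GI_def)
  show "G (s, u) < G (t, u)" if "0 < s" "s < t" "norm u = 1" for s t u
  proof -
    have "strict_mono_on {0<..} (\<lambda>t. G (t, u))" using G that by (simp add: class_GI_def)
    from strict_mono_onD[OF this, of s t] show ?thesis using that by simp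
  qed
  show "convex_on {0<..} (\<lambda>t. G (t, u))" if "norm u = 1" for u using conv that by simp
  define c where "c = (INF (t, u)\<in>{1..} \<times> sphere 0 1. G (t, u) / t powr q)"
  have "bdd_below ((\<lambda>(t, u). G (t, u) / t powr q) ` ({1..} \<times> sphere 0 1))"
    using pos by (intro bdd_belowI2[where m=0]) (auto simp: less_imp_le)
  then have le: "c \<le> G (t, u) / t powr q" if "1 \<le> t" "norm u = 1" for t u
    unfolding c_def using that cINF_lower[of "\<lambda>(t, u). G (t, u) / t powr q" _ "(t, u)"] by auto
  have "c * t ^ (DIM('a) - 1) \<le> G (t, u)" if t: "1 \<le> t" "norm u = 1" for t u
  proof -
    have "t ^ (DIM('a) - 1) = t powr real (DIM('a) - 1)" using t by (subst powr_realpow) auto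
    also have "\<dots> \<le> t powr q" using t q by (intro powr_mono) (auto simp: of_nat_diff)
    finally have "c * t ^ (DIM('a) - 1) \<le> c * t powr q"
      using growth by (intro mult_left_mono) (auto simp: c_def)
    also have "\<dots> \<le> G (t, u)" using le[OF t] t by (simp add: field_simps)
    finally show ?thesis .
  qed
  then show "\<exists>c>0. \<exists>T>0. \<forall>t\<ge>T. \<forall>u. norm u = 1 \<longrightarrow> c * t ^ (DIM('a) - 1) \<le> G (t, u)"
    using growth by (intro exI[of _ c] conjI exI[of _ 1]) (auto simp: c_def)
qed

theorem corollary4p8:
  fixes \<mu>s :: "nat \<Rightarrow> (real ^ 'n) measure" and \<mu> :: "(real ^ 'n) measure"
    and G :: "real \<times> (real ^ 'n) \<Rightarrow> real" and \<phi> :: "real \<Rightarrow> real" and q :: real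
  assumes "CARD('n) \<ge> 2"
    and "\<And>i. finite_borel_measure_on_sphere (\<mu>s i)"
    and "\<And>i. emeasure (\<mu>s i) (space (\<mu>s i)) \<noteq> 0"
    and "\<And>i. not_conc_on_closed_hemisphere (\<mu>s i)"
    and "finite_borel_measure_on_sphere \<mu>"
    and "emeasure \<mu> (space \<mu>) \<noteq> 0"
    and "not_conc_on_closed_hemisphere \<mu>"
    and "weakly_converges \<mu>s \<mu>"
    and "G \<in> class_GI"
    and "\<And>u. u \<in> sphere 0 1 \<Longrightarrow> convex_on {0<..} (\<lambda>t. G (t, u))"
    and "q \<ge> real CARD('n) - 1"
    and "(INF (t, u)\<in>{1..} \<times> sphere 0 1. G (t, u) / t powr q) > 0"
    and "\<phi> \<in> class_I"
    and "convex_on {0<..} \<phi>"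
  shows "(\<forall>Ms M. (\<forall>i. is_minimizer \<phi> (\<mu>s i) (B_tilde G) (Ms i)) \<and>
              is_minimizer \<phi> \<mu> (B_tilde G) M \<longrightarrow>
            (\<lambda>i. hausdorff_dist (Ms i) M) \<longlonglongrightarrow> 0) \<and>
         (\<forall>Ms M. (\<forall>i. is_minimizer \<phi> (\<mu>s i) (B_hat G) (Ms i)) \<and>
              is_minimizer \<phi> \<mu> (B_hat G) M \<longrightarrow>
            (\<lambda>i. hausdorff_dist (Ms i) M) \<longlonglongrightarrow> 0)"
proof -
  have dim: "2 \<le> DIM(real ^ 'n)" using assms(1) by simp
  interpret dual_volume_integrand G
    using assms(9-12) by (intro class_GI_integrand[where q=q]) auto
  \<comment> \<open>The integrand stays open here, so that the result serves both \<open>G\<close>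
    and its rescaled version.\<close>
  note conv = dual_volume_integrand.minimizers_converge[OF _ dim assms(8,2,5,6,7,14,13)]
  have lim0: "((\<lambda>t. G (t, u)) \<longlongrightarrow> 0) (at_right 0)" if "norm u = 1" for u
    using assms(9) that by (simp add: class_GI_def)
  obtain \<eta> where \<eta>: "0 < \<eta>" "B_hat G = B_tilde (\<lambda>p. G (fst p / \<eta>, snd p))"
    using B_hat_eq_B_tilde[OF dim lim0] by blast
  show ?thesis
    using conv[OF dual_volume_integrand_axioms] conv[OF scaled_integrand[OF \<eta>(1)]] unfolding \<eta>(2)
    by blast
qed

end
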